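(* Let $\mathbf{e}=\mathbf{e_n}=(0,\dots,0,1)$ and write $x=(x',x_n)\in\mathbb{R}^{n-1}\times\mathbb{R}$. Let $\Omega=\{x\in\mathbb{R}^n : x_n>\varphi(x')\}$ be a coercive epigraph, let $0<s<1$, and let $u\in\mathcal{L}_s(\mathbb{R}^n)\cap C^{1,1}_{loc}(\Omega)\cap C(\overline\Omega)$ be a solution to $$\begin{cases}-\mathbf{F_s}u(x)=f(x,u(x),\nabla u(x)) & \text{in }\Omega,\\ u>0 & \text{in }\Omega,\\ u\equiv 0 & \text{in }\mathbb{R}^n\setminus\Omega.\end{cases}$$ Suppose that $f(x,u,\mathbf{p})\in\mathcal{F}$ and satisfies $$f(x',x_n,u,p_1,p_2,\dots,p_n)\le f(x',\bar x_n,u,p_1,p_2,\dots,-p_n)\qquad\forall\,x_n\ge\min_{\mathbb{R}^{n-1}}\varphi,\ p_n\ge 0,\ \bar x_n\ge x_n$$ (at points where $f$ is defined). Then $u$ is strictly monotone increasing in $x_n$ (in $\Omega$).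
   Context: Let $n\ge 2$ and $0<\theta\le\Theta<\infty$. For $0<s<1$, $\mathcal{L}_s(\mathbb{R}^n)$ is the set of functions $u:\mathbb{R}^n\to\mathbb{R}$ with $\int_{\mathbb{R}^n}\frac{|u(x)|}{1+|x|^{n+2s}}\,dx<+\infty$. $C^{1,1}_{loc}(\Omega)$ denotes functions that are $C^1$ with locally Lipschitz gradient in $\Omega$. For the unit vector $\mathbf{e}$ and $u\in\mathcal{L}_s(\mathbb{R}^n)$ that is $C^{1,1}$ near $x$, $$\mathbf{F_s}u(x):=\inf\left\{P.V.\int_{\mathbb{R}^n}\frac{u(y)-u(x)}{|A^{-1}(y-x)|^{n+2s}}\,dy \;:\; A \text{ a real symmetric } n\times n \text{ matrix},\ \theta I\le A\le\Theta I,\ \mathbf{e} \text{ is an eigenvector of } A\right\}.$$ A domain $\Omega\subseteq\mathbb{R}^n$ is a coercive epigraph if $\Omega=\{x=(x',x_n) : x_n>\varphi(x')\}$ for some continuous $\varphi:\mathbb{R}^{n-1}\to\mathbb{R}$ with $\lim_{|x'|\to+\infty}\varphi(x')=+\infty$. $\mathcal{F}$ is the collection of functions $f(x,u,\mathbf{p}):\Omega\times\mathbb{R}\times\mathbb{R}^n\to\mathbb{R}$ which are locally Lipschitz in $u$, uniformly in $\mathbf{p}$ and locally uniformly in $x$: for any $M>0$ and any compact subset $K\subset\overline\Omega$ there exists $C_{K,M}>0$ such that for all $u_1,u_2\in[-M,M]$, all $x\in K$ and all $\mathbf{p}\in\mathbb{R}^n$, $|f(x,u_1,\mathbf{p})-f(x,u_2,\mathbf{p})|\le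 C_{K,M}|u_1-u_2|$ (for those $x$ at which $f$ is defined). *)

theory Defs
  imports "HOL-Analysis.Analysis"
begin

definition gradient :: "('a::euclidean_space \<Rightarrow> real) \<Rightarrow> 'a \<Rightarrow> 'a" where
  "gradient u x = (THE D. GDERIV u x :> D)"

definition C11_loc :: "'a::euclidean_space set \<Rightarrow> ('a \<Rightarrow> real) set" where
  "C11_loc \<Omega> = {u.
     (\<forall>x\<in>\<Omega>. GDERIV u x :> gradient u x) \<and>
     continuous_on \<Omega> (gradient u) \<and>
     (\<forall>x\<in>\<Omega>. \<exists>r>0. \<exists>L. L-lipschitz_on (ball x r \<inter> \<Omega>) (gradient u))}"

definition L_space :: "real \<Rightarrow> (real ^ 'n \<Rightarrow> real) set" where
  "L_space s = {u. u \<in> borel_measurable lebesgue \<and>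
     integrable lebesgue (\<lambda>x. \<bar>u x\<bar> / (1 + norm x powr (real CARD('n) + 2 * s)))}"


text \<open>The principal value removes balls around the singular point \<^term>\<open>x\<close>.\<close>

definition pv_integral :: "'a::euclidean_space \<Rightarrow> ('a \<Rightarrow> real) \<Rightarrow> real" where
  "pv_integral x g = Lim (at_right 0) (\<lambda>\<epsilon>. LINT y:- ball x \<epsilon>|lebesgue. g y)"

definition loewner_le :: "real ^ 'n ^ 'n \<Rightarrow> real ^ 'n ^ 'n \<Rightarrow> bool" where
  "loewner_le A B \<longleftrightarrow> (\<forall>v. v \<bullet> (A *v v) \<le> v \<bullet> (B *v v))"

definition is_eigenvector :: "real ^ 'n ^ 'n \<Rightarrow> real ^ 'n \<Rightarrow> bool" where
  "is_eigenvector A v \<longleftrightarrow> v \<noteq> 0 \<and> (\<exists>c. A *v v = c *\<^sub>R v)"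

text \<open>In \<^term>\<open>loewner_le (mat \<theta>) A\<close>, \<^term>\<open>mat \<theta>\<close> is \<^term>\<open>\<theta>\<close> times the identity matrix.\<close>

definition admissible :: "real \<Rightarrow> real \<Rightarrow> real ^ 'n \<Rightarrow> (real ^ 'n ^ 'n) set" where
  "admissible \<theta> \<Theta> e = {A. transpose A = A \<and> loewner_le (mat \<theta>) A \<and> loewner_le A (mat \<Theta>)
     \<and> is_eigenvector A e}"

text \<open>The real-valued infimum below is the true one for \<open>0 < \<theta> \<le> \<Theta>\<close>, \<open>e \<noteq> 0\<close>, \<open>0 < s < 1\<close>,
  \<open>u \<in> L_space s\<close> and \<open>u\<close> of class \<open>C\<^sup>1\<^sup>,\<^sup>1\<close> near \<open>x\<close>: the set is then nonempty
  (it contains the value for \<^term>\<open>mat \<theta>\<close>) and bounded.\<close>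

definition Fs ::
  "real \<Rightarrow> real \<Rightarrow> real ^ 'n \<Rightarrow> real \<Rightarrow> (real ^ 'n \<Rightarrow> real) \<Rightarrow> real ^ 'n \<Rightarrow> real" where
  "Fs \<theta> \<Theta> e s u x =
     (INF A \<in> admissible \<theta> \<Theta> e.
        pv_integral x (\<lambda>y. (u y - u x) /
          norm (matrix_inv A *v (y - x)) powr (real CARD('n) + 2 * s)))"

text \<open>\<open>f\<close> is a total function, but only its values at points \<open>x \<in> \<Omega>\<close> are ever constrained.\<close>

definition F_class ::
  "'a::euclidean_space set \<Rightarrow> ('a \<Rightarrow> real \<Rightarrow> 'a \<Rightarrow> real) set" where
  "F_class \<Omega> = {f. \<forall>M>0. \<forall>K. compact K \<and> K \<subseteq> closure \<Omega> \<longrightarrow>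
     (\<exists>C>0. \<forall>u1\<in>{-M..M}. \<forall>u2\<in>{-M..M}. \<forall>x\<in>K \<inter> \<Omega>. \<forall>p.
        \<bar>f x u1 p - f x u2 p\<bar> \<le> C * \<bar>u1 - u2\<bar>)}"


text \<open>With \<open>n - 1\<close> = \<^term>\<open>CARD('m::finite)\<close>, the space \<open>R\<^sup>n\<close> is \<^typ>\<open>real ^ ('m::finite option)\<close>:
  index \<^term>\<open>None\<close> is the last coordinate and the indices \<^term>\<open>Some j\<close> are the first \<open>n - 1\<close>,
  so that \<open>n \<ge> 2\<close> ranges over all possibilities. The vector \<open>(x', t)\<close> is \<^term>\<open>pt x' t\<close>.\<close>

definition pt :: "real ^ 'm \<Rightarrow> real \<Rightarrow> real ^ ('m option)" where
  "pt x' t = (\<chi> i. case i of None \<Rightarrow> t | Some j \<Rightarrow> x' $ j)"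

definition e_last :: "real ^ ('m::finite option)" where
  "e_last = axis None 1"

definition epigraph_set :: "(real ^ 'm \<Rightarrow> real) \<Rightarrow> (real ^ ('m option)) set" where
  "epigraph_set \<phi> = {pt x' t | x' t. t > \<phi> x'}"

definition coercive :: "(real ^ 'm \<Rightarrow> real) \<Rightarrow> bool" where
  "coercive \<phi> \<longleftrightarrow> filterlim \<phi> at_top at_infinity"

end

(*
  Moving planes, run on all planes at once. Consider D(x',a,b) = u(x',b) - u(x',a) over the compact
  set of (x',a,b) with phi(x') <= a <= b and a + b <= 2 lambda. At a minimiser with a < b the
  horizontal derivatives at P = (x',a) and Q = (x',b) agree; varying a and b with a + b fixed
  gives d_n u(Q) = - d_n u(P), and lowering b (which is allowed) gives d_n u(Q) <= 0. Hence
  d_n u(P) >= 0 and the structure condition on f applies: the sign of d_n u comes from minimising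
  over the plane as well as over the point.

  Let d = (b - a)/2 be the distance of P to the plane mu = (a + b)/2, and m = D(x',a,b) <= 0.
  Kernels that have e_n as eigenvector are invariant under the reflection and larger on the near
  side, so folding the principal values along the plane yields
    Fs u(Q) - Fs u(P) >= delta + c |m| d^(-2s)   with delta > 0,
  uniformly in the matrix A, while the equation and the Lipschitz bound on f give at most C |m|.
  So m < 0 (strong maximum principle) and d is bounded below (narrow region principle) at every
  such minimiser. Both together exclude a lowest pair with b - a bounded below and D <= 0.
*)
theory Submission
  imports Defs
begin

section \<open>Admissible matrices\<close>

text \<open>Two infima are compared matrix by matrix, so every constant in the kernel estimates may
  depend on the matrix only through \<open>\<theta>\<close> and \<open>\<Theta>\<close>. The
  principal values are limits, so the folding is done on truncated integrals. Removing a ball around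
  \<open>P\<close> leaves the mirror ball around \<open>Q\<close> unmatched, and its contribution
  has to be absorbed into \<open>\<delta>\<close>. The strict term \<open>\<delta>\<close> comes
  from outside the domain: just below the graph \<open>u\<close> vanishes, while the mirror point
  lies in the domain and \<open>u\<close> is positive there. The reflected difference thus exceeds
  its minimum by a fixed amount on a small ball, even when \<open>m = 0\<close>. The power of
  \<open>d\<close> comes from the ball of radius \<open>d\<close> around \<open>P\<close>: its
  points are within \<open>3 * d\<close> of \<open>P\<close> after reflection, so a volume of order
  \<open>d^n\<close> meets a kernel of order \<open>d^(-n-2s)\<close>. Pairs with
  \<open>a = b\<close> have increment 0 and can never be excluded. The lower bound on
  \<open>d\<close> is what permits replacing all pairs by the closed set of wide ones, on which a
  lowest pair exists.\<close>

lemma matrix_inv_mult_vec: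
  fixes A :: "real ^ 'n ^ 'n"
  assumes "invertible A"
  shows "A *v (matrix_inv A *v z) = z" and "matrix_inv A *v (A *v z) = z"
proof -
  have "A ** matrix_inv A = mat 1 \<and> matrix_inv A ** A = mat 1"
    using someI_ex[of "\<lambda>A'. A ** A' = mat 1 \<and> A' ** A = mat 1"] assms
    unfolding invertible_def matrix_inv_def by blast
  then show "A *v (matrix_inv A *v z) = z" and "matrix_inv A *v (A *v z) = z"
    by (simp_all add: matrix_vector_mul_assoc)
qed

lemma mat_mult_vec: "mat c *v (v :: real ^ 'n) = c *\<^sub>R v"
  by (simp add: vec_eq_iff matrix_vector_mult_def mat_def if_distrib[of "\<lambda>x. x * _"] cong: if_cong)

text \<open>These bounds make all later kernel estimates uniform over the infimum. The lower bound
  is Cauchy-Schwarz for the quadratic form; the upper one comes, without diagonalising, from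
  positivity of the form at a single test vector.\<close>

lemma admissible_bounds:
  assumes A: "A \<in> admissible \<theta> \<Theta> e" and \<theta>: "0 < \<theta>"
  shows "invertible A"
    and "norm z \<le> \<Theta> * norm (matrix_inv A *v z)"
    and "\<theta> * norm (matrix_inv A *v z) \<le> norm z"
proof -
  have sym: "x \<bullet> (A *v y) = (A *v x) \<bullet> y" for x y
  proof -
    have "transpose A = A" using A by (simp add: admissible_def)
    then have "A *v x = x v* A" by (metis vector_transpose_matrix)
    then show ?thesis by (simp add: dot_lmul_matrix)
  qed
  have lo: "\<theta> * (v \<bullet> v) \<le> v \<bullet> (A *v v)" and up: "v \<bullet> (A *v v) \<le> \<Theta> * (v \<bullet> v)" for v
    using A by (auto simp: admissible_def loewner_le_def mat_mult_vec)
  have lower: "\<theta> * norm v \<le> norm (A *v v)" for v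
  proof (cases "v = 0")
    case False
    have "\<theta> * norm v * norm v \<le> norm v * norm (A *v v)"
      using lo[of v] norm_cauchy_schwarz[of v "A *v v"]
      by (simp add: power2_norm_eq_inner[symmetric] power2_eq_square mult.assoc)
    with False show ?thesis by (simp add: mult.commute)
  qed simp
  \<comment> \<open>Testing both forms on a unit vector gives
    \<open>\<theta> \<le> \<Theta>\<close>, hence \<open>0 < \<Theta>\<close>.\<close>
  have "\<theta> * (axis undefined 1 \<bullet> (axis undefined 1 :: real ^ 'a)) \<le> \<Theta> * (axis undefined 1 \<bullet> (axis undefined 1 :: real ^ 'a))"
    using lo up order_trans by blast
  then have \<Theta>: "\<Theta> > 0" using \<theta> by (simp add: inner_axis_axis)
  have upper: "norm (A *v v) \<le> \<Theta> * norm v" for v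
  proof -
    \<comment> \<open>This value minimises \<open>\<Theta> * t\<^sup>2 - 2 * t\<close>, the
      coefficient of the squared norm of \<open>A *v v\<close> in the estimate below.\<close>
    define t where "t = 1 / \<Theta>"
    have "t \<ge> 0" using \<Theta> by (simp add: t_def)
    let ?w = "v - t *\<^sub>R (A *v v)"
    have "0 \<le> ?w \<bullet> (A *v ?w)"
      using lo[of ?w] \<theta> by (meson inner_ge_zero less_imp_le mult_nonneg_nonneg order_trans)
    also have "\<dots> = v \<bullet> (A *v v) - 2 * t * ((A *v v) \<bullet> (A *v v)) + t\<^sup>2 * ((A *v v) \<bullet> (A *v (A *v v)))"
      by (simp add: matrix_vector_mult_diff_distrib matrix_vector_mult_scaleR inner_diff_left inner_diff_right
          sym[of v "A *v v"] power2_eq_square algebra_simps)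
    also have "\<dots> \<le> \<Theta> * (v \<bullet> v) - 2 * t * ((A *v v) \<bullet> (A *v v)) + t\<^sup>2 * (\<Theta> * ((A *v v) \<bullet> (A *v v)))"
      using up[of v] up[of "A *v v"] \<open>t \<ge> 0\<close> by (intro add_mono diff_mono mult_left_mono) auto
    also have "\<dots> = \<Theta> * (v \<bullet> v) - ((A *v v) \<bullet> (A *v v)) / \<Theta>"
      using \<Theta> by (simp add: t_def power2_eq_square field_simps)
    finally have "(A *v v) \<bullet> (A *v v) \<le> \<Theta>\<^sup>2 * (v \<bullet> v)"
      using \<Theta> by (simp add: field_simps power2_eq_square)
    then have "(norm (A *v v))\<^sup>2 \<le> (\<Theta> * norm v)\<^sup>2"
      by (simp add: power2_norm_eq_inner power_mult_distrib)
    from power2_le_imp_le[OF this] show ?thesis using \<Theta> by simp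
  qed
  have "\<forall>x. A *v x = 0 \<longrightarrow> x = 0"
    using lower \<theta> by (metis mult_le_0_iff norm_eq_zero norm_le_zero_iff not_le)
  then show inv: "invertible A"
    by (simp add: invertible_left_inverse matrix_left_invertible_ker)
  show "norm z \<le> \<Theta> * norm (matrix_inv A *v z)" "\<theta> * norm (matrix_inv A *v z) \<le> norm z"
    using upper[of "matrix_inv A *v z"] lower[of "matrix_inv A *v z"]
    by (simp_all add: matrix_inv_mult_vec(1)[OF inv])
qed

text \<open>Here the eigenvector condition enters: if \<open>A\<close> scales the axis vector by
  \<open>\<alpha>\<close>, then \<open>matrix_inv A\<close> scales it by
  \<open>\<beta> = 1 / \<alpha>\<close>, and symmetry reduces the cross term to the coordinate
  \<open>z $ k\<close>. For \<open>\<tau> = - 2 * z $ k\<close> the correction vanishes, so the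
  kernel is invariant under reflection; other shifts measure how much farther away a mirror image
  is.\<close>

lemma admissible_shift:
  fixes A :: "real ^ 'n ^ 'n"
  assumes A: "A \<in> admissible \<theta> \<Theta> (axis k 1)" and \<theta>: "0 < \<theta>"
  obtains \<beta> where "1 / \<Theta> \<le> \<beta>" "\<And>z \<tau>. (norm (matrix_inv A *v (z + \<tau> *\<^sub>R axis k 1)))\<^sup>2
      = (norm (matrix_inv A *v z))\<^sup>2 + \<beta>\<^sup>2 * (2 * \<tau> * z $ k + \<tau>\<^sup>2)"
proof -
  note inv = admissible_bounds(1)[OF A \<theta>]
  have sym: "x \<bullet> (A *v y) = (A *v x) \<bullet> y" for x y
  proof -
    have "transpose A = A" using A by (simp add: admissible_def)
    then have "A *v x = x v* A" by (metis vector_transpose_matrix)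
    then show ?thesis by (simp add: dot_lmul_matrix)
  qed
  obtain \<alpha> where \<alpha>: "A *v axis k 1 = \<alpha> *\<^sub>R axis k 1"
    using A by (auto simp: admissible_def is_eigenvector_def)
  have "\<theta> \<le> \<alpha>" "\<alpha> \<le> \<Theta>"
    using A \<alpha> unfolding admissible_def loewner_le_def
    by (auto simp: mat_mult_vec inner_axis_axis dest!: spec[of _ "axis k 1"])
  with \<theta> have pos: "\<alpha> > 0" "1 / \<Theta> \<le> 1 / \<alpha>" by (auto intro: divide_left_mono)
  have e: "matrix_inv A *v axis k 1 = (1 / \<alpha>) *\<^sub>R axis k 1"
    using matrix_inv_mult_vec(2)[OF inv, of "axis k 1"] pos(1)
    by (auto simp: \<alpha> matrix_vector_mult_scaleR divideR_right[symmetric] divide_inverse_commute)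
  have "(norm (matrix_inv A *v (z + \<tau> *\<^sub>R axis k 1)))\<^sup>2
      = (norm (matrix_inv A *v z))\<^sup>2 + (1 / \<alpha>)\<^sup>2 * (2 * \<tau> * z $ k + \<tau>\<^sup>2)" for z \<tau>
  proof -
    define v where "v = matrix_inv A *v z"
    have "z \<bullet> axis k 1 = v \<bullet> (A *v axis k 1)"
      by (simp add: sym v_def matrix_inv_mult_vec(1)[OF inv])
    then have "v \<bullet> axis k 1 = z $ k / \<alpha>"
      using pos by (simp add: \<alpha> inner_axis field_simps)
    then show ?thesis
      using pos(1) by (simp add: matrix_vector_right_distrib matrix_vector_mult_scaleR e v_def[symmetric]
          power2_norm_eq_inner inner_add_left inner_add_right inner_axis_axis inner_commute[of "axis k 1" v])
        (simp add: field_simps power2_eq_square)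
  qed
  then show ?thesis using that pos(2) by blast
qed

lemma mat_admissible:
  assumes "\<theta> \<le> \<Theta>" "e \<noteq> 0"
  shows "mat \<theta> \<in> admissible \<theta> \<Theta> e"
  using assms by (auto simp: admissible_def loewner_le_def is_eigenvector_def mat_mult_vec
      transpose_mat intro!: mult_right_mono)

section \<open>Integrals of radial powers\<close>

text \<open>Common form of the changes of variables used later: translation, point reflection and
  reflection in a coordinate hyperplane. The signs have modulus 1, so the Jacobian factor is
  1.\<close>

lemma lebesgue_signed_translation:
  fixes t :: "'a::euclidean_space" and c :: "'a \<Rightarrow> real" and f :: "'a \<Rightarrow> real"
  assumes c: "\<And>j. j \<in> Basis \<Longrightarrow> \<bar>c j\<bar> = 1" and f: "f \<in> borel_measurable lebesgue"
  defines "T \<equiv> (\<lambda>x. t + (\<Sum>j\<in>Basis. (c j * (x \<bullet> j)) *\<^sub>R j))"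
  shows "(\<lambda>x. f (T x)) \<in> borel_measurable lebesgue"
    and "integrable lebesgue (\<lambda>x. f (T x)) \<longleftrightarrow> integrable lebesgue f"
    and "(LINT x|lebesgue. f (T x)) = (LINT x|lebesgue. f x)"
proof -
  have c0: "c j \<noteq> 0" if "j \<in> Basis" for j using c[OF that] by auto
  have T: "T \<in> lebesgue \<rightarrow>\<^sub>M lebesgue"
    unfolding T_def by (rule lebesgue_affine_measurable[OF c0])
  have "(\<Prod>j\<in>Basis. \<bar>c j\<bar>) = 1" using c by simp
  then have D: "distr lebesgue lebesgue T = lebesgue"
    using lebesgue_affine_euclidean[of c t, OF c0] by (simp add: T_def density_1)
  show "(\<lambda>x. f (T x)) \<in> borel_measurable lebesgue"
    using measurable_compose[OF T f] .
  show "integrable lebesgue (\<lambda>x. f (T x)) \<longleftrightarrow> integrable lebesgue f"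
    using integrable_distr_eq[OF T, of f] f by (simp add: D)
  show "(LINT x|lebesgue. f (T x)) = (LINT x|lebesgue. f x)"
    using integral_distr[OF T, of f] f by (simp add: D)
qed

lemma sum_Basis_scaleR_const:
  fixes x :: "'a::euclidean_space"
  shows "(\<Sum>j\<in>Basis. (c * (x \<bullet> j)) *\<^sub>R j) = c *\<^sub>R x"
proof -
  have "(\<Sum>j\<in>Basis. (c * (x \<bullet> j)) *\<^sub>R j) = c *\<^sub>R (\<Sum>j\<in>Basis. (x \<bullet> j) *\<^sub>R j)"
    by (simp add: scaleR_sum_right)
  then show ?thesis by (simp add: euclidean_representation)
qed

lemma lebesgue_translate:
  fixes f :: "'a::euclidean_space \<Rightarrow> real"
  assumes f: "f \<in> borel_measurable lebesgue"
  shows "(\<lambda>x. f (t + x)) \<in> borel_measurable lebesgue"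
    and "integrable lebesgue (\<lambda>x. f (t + x)) \<longleftrightarrow> integrable lebesgue f"
    and "(LINT x|lebesgue. f (t + x)) = (LINT x|lebesgue. f x)"
    and "(\<lambda>x. f (t - x)) \<in> borel_measurable lebesgue"
    and "integrable lebesgue (\<lambda>x. f (t - x)) \<longleftrightarrow> integrable lebesgue f"
    and "(LINT x|lebesgue. f (t - x)) = (LINT x|lebesgue. f x)"
  using lebesgue_signed_translation[OF _ f, of "\<lambda>_. 1" t] lebesgue_signed_translation[OF _ f, of "\<lambda>_. -1" t]
  unfolding sum_Basis_scaleR_const by simp_all

text \<open>Radial powers are integrated by covering the space with dyadic balls.\<close>

lemma integrable_ball_cover:
  fixes g :: "'a::euclidean_space \<Rightarrow> real"
  assumes g: "g \<in> borel_measurable lebesgue" and c: "\<And>k. 0 \<le> c k" and r: "\<And>k. 0 \<le> r k"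
    and sm: "summable (\<lambda>k::nat. c k * r k ^ DIM('a))"
    and cover: "\<And>z. g z \<noteq> 0 \<Longrightarrow> \<exists>k. norm z < r k \<and> \<bar>g z\<bar> \<le> c k"
  shows "integrable lebesgue g"
proof (rule integrableI_bounded[OF g])
  let ?V = "unit_ball_vol (real DIM('a))"
  have "(\<integral>\<^sup>+z. ennreal (norm (g z)) \<partial>lebesgue)
      \<le> (\<integral>\<^sup>+z. (\<Sum>k. ennreal (c k) * indicator (ball (0::'a) (r k)) z) \<partial>lebesgue)"
  proof (rule nn_integral_mono)
    fix z :: 'a
    show "ennreal (norm (g z)) \<le> (\<Sum>k. ennreal (c k) * indicator (ball 0 (r k)) z)"
    proof (cases "g z = 0")
      case False
      then obtain k where k: "norm z < r k" "\<bar>g z\<bar> \<le> c k" using cover by blast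
      have "ennreal (norm (g z)) \<le> ennreal (c k) * indicator (ball 0 (r k)) z"
        using k by (simp add: ennreal_leI)
      also have "\<dots> = sum (\<lambda>i. ennreal (c i) * indicator (ball 0 (r i)) z) {k}"
        by (simp del: sum_mult_indicator)
      also have "\<dots> \<le> (\<Sum>k. ennreal (c k) * indicator (ball 0 (r k)) z)"
        by (rule sum_le_suminf) auto
      finally show ?thesis .
    qed simp
  qed
  also have "\<dots> = (\<Sum>k. \<integral>\<^sup>+z. ennreal (c k) * indicator (ball (0::'a) (r k)) z \<partial>lebesgue)"
    by (rule nn_integral_suminf)
      (intro borel_measurable_times_ennreal borel_measurable_const borel_measurable_indicator, simp)
  also have "\<dots> = (\<Sum>k. ennreal (c k * (?V * r k ^ DIM('a))))"
    using c r by (simp add: nn_integral_cmult_indicator emeasure_ball ennreal_mult)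
  also have "\<dots> < \<infinity>"
  proof -
    have "summable (\<lambda>k. c k * (?V * r k ^ DIM('a)))"
      using summable_mult[OF sm, of ?V] by (simp add: mult_ac)
    then show ?thesis
      using c r by (subst suminf_ennreal2) auto
  qed
  finally show "(\<integral>\<^sup>+z. ennreal (norm (g z)) \<partial>lebesgue) < \<infinity>" .
qed

lemma measurable_lebesgue_borel:
  "f \<in> borel_measurable borel \<Longrightarrow> f \<in> borel_measurable lebesgue"
  by (simp add: measurable_completion)

text \<open>The square in the numerator is what a second difference of a \<open>C^{1,1}\<close>
  function supplies; with \<open>p = n + 2 * s\<close> the condition on \<open>p\<close> becomes
  \<open>s < 1\<close>.\<close>

lemma integrable_power_at_0:
  assumes p: "p < real DIM('a::euclidean_space) + 2" "0 \<le> p"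
  shows "integrable lebesgue (\<lambda>z::'a. indicator (ball 0 1) z * ((norm z)\<^sup>2 / norm z powr p))" (is "integrable _ ?g")
proof -
  let ?n = "real DIM('a)"
  define r where "r k = 2 powr (- real k)" for k :: nat
  \<comment> \<open>On the shell \<open>2^(-k-1) \<le> |z| < 2^(-k)\<close> the numerator is at most
    \<open>2^(-2k)\<close> and the inverse power at most \<open>2^(p(k+1))\<close>; bounding them
    separately works for either sign of \<open>p - 2\<close>.\<close>
  define c where "c k = 2 powr (p + (p - 2) * real k)" for k :: nat
  have p2: "norm ((2::real) powr (p - 2 - ?n)) < 1"
    using p powr_less_mono[of "p - 2 - ?n" 0 2] by simp
  have "c k * r k ^ DIM('a) = 2 powr p * (2 powr (p - 2 - ?n)) ^ k" for k
  proof -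
    have "r k ^ DIM('a) = 2 powr (- real k * ?n)"
      unfolding r_def by (subst powr_realpow[symmetric]) (simp_all add: powr_powr)
    moreover have "(2 powr (p - 2 - ?n)) ^ k = 2 powr ((p - 2 - ?n) * real k)"
      by (subst powr_realpow[symmetric]) (simp_all add: powr_powr)
    moreover have "p + (p - 2) * real k + - real k * ?n = p + (p - 2 - ?n) * real k"
      by (simp add: algebra_simps)
    ultimately show ?thesis unfolding c_def by (metis powr_add)
  qed
  then have summ: "summable (\<lambda>k. c k * r k ^ DIM('a))"
    by (simp only: summable_mult[OF summable_geometric[OF p2]])
  show ?thesis
  proof (rule integrable_ball_cover[OF _ _ _ summ])
    show "?g \<in> borel_measurable lebesgue"
      by (intro measurable_lebesgue_borel borel_measurable_times borel_measurable_indicator) auto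
    fix z :: 'a
    assume "?g z \<noteq> 0"
    then have z01: "0 < norm z" "norm z < 1" by (auto split: split_indicator_asm)
    define t where "t = log 2 (norm z)"
    \<comment> \<open>The ceiling minus one, rather than the floor of \<open>- t\<close>, gives the
      strict inequality \<open>t < - real k\<close>, so that a point whose norm is a power of 2
      still lies in the open ball.\<close>
    define k where "k = nat (\<lceil>- t\<rceil> - 1)"
    have tz: "norm z = 2 powr t" using z01 by (simp add: t_def)
    have "t < 0" using z01 by (simp add: t_def)
    then have "real_of_int \<lceil>- t\<rceil> - 1 = real k" by (simp add: k_def)
    then have k: "t < - real k" "- real k - 1 \<le> t"
      using ceiling_correct[of "- t"] by linarith+
    have "(norm z)\<^sup>2 / norm z powr p = 2 powr (2 * t - p * t)"
      unfolding tz by (simp add: powr_diff powr_powr mult.commute powr_realpow[symmetric] del: powr_realpow')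
    also have "\<dots> \<le> c k"
    proof -
      have "(- t - real k) * p \<le> 1 * p" using k p by (intro mult_right_mono) auto
      then show ?thesis unfolding c_def using k by (intro powr_mono) (auto simp: algebra_simps)
    qed
    finally show "\<exists>k. norm z < r k \<and> \<bar>?g z\<bar> \<le> c k"
      using z01 k by (intro exI[of _ k]) (auto simp: r_def tz)
  qed (auto simp: c_def r_def)
qed

lemma integrable_power_at_infinity:
  assumes p: "real DIM('a::euclidean_space) < p"
  shows "integrable lebesgue (\<lambda>z::'a. indicator (- ball 0 1) z * (1 / norm z powr p))" (is "integrable _ ?g")
proof -
  let ?n = "real DIM('a)"
  define r where "r k = 2 powr (real k + 1)" for k :: nat
  define c where "c k = 2 powr (- p * real k)" for k :: nat
  have p2: "norm ((2::real) powr (?n - p)) < 1"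
    using p powr_less_mono[of "?n - p" 0 2] by simp
  have "c k * r k ^ DIM('a) = 2 powr ?n * (2 powr (?n - p)) ^ k" for k
  proof -
    have "r k ^ DIM('a) = 2 powr ((real k + 1) * ?n)"
      unfolding r_def by (subst powr_realpow[symmetric]) (simp_all add: powr_powr)
    moreover have "(2 powr (?n - p)) ^ k = 2 powr ((?n - p) * real k)"
      by (subst powr_realpow[symmetric]) (simp_all add: powr_powr)
    moreover have "- p * real k + (real k + 1) * ?n = ?n + (?n - p) * real k"
      by (simp add: algebra_simps)
    ultimately show ?thesis unfolding c_def by (metis powr_add)
  qed
  then have summ: "summable (\<lambda>k. c k * r k ^ DIM('a))"
    by (simp only: summable_mult[OF summable_geometric[OF p2]])
  show ?thesis
  proof (rule integrable_ball_cover[OF _ _ _ summ])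
    show "?g \<in> borel_measurable lebesgue"
      by (intro measurable_lebesgue_borel borel_measurable_times borel_measurable_indicator) auto
    fix z :: 'a
    assume "?g z \<noteq> 0"
    then have z1: "1 \<le> norm z" by (auto split: split_indicator_asm)
    define t where "t = log 2 (norm z)"
    define k where "k = nat \<lfloor>t\<rfloor>"
    have tz: "norm z = 2 powr t"
      using powr_log_cancel[of 2 "norm z"] z1 unfolding t_def by linarith
    have "t \<ge> 0" unfolding t_def by (subst zero_le_log_cancel_iff) (use z1 in linarith)+
    then have k: "real k \<le> t" "t < real k + 1"
      by (auto simp: k_def)
    have "1 / norm z powr p = 2 powr (- p * t)"
      unfolding tz by (simp add: powr_powr powr_minus divide_inverse mult.commute)
    also have "\<dots> \<le> c k"
      unfolding c_def using k p by (intro powr_mono) (auto intro!: mult_left_mono)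
    finally show "\<exists>k. norm z < r k \<and> \<bar>?g z\<bar> \<le> c k"
      using z1 k by (intro exI[of _ k]) (auto simp: r_def tz)
  qed (auto simp: c_def r_def)
qed

section \<open>Principal values\<close>

lemma norm_matrix_powr_measurable:
  "(\<lambda>y. norm (B *v (y - x)) powr p) \<in> borel_measurable (lebesgue :: (real ^ 'n) measure)"
proof -
  have "continuous_on UNIV (\<lambda>y. norm (B *v (y - x)))"
    by (intro continuous_on_norm bounded_linear.continuous_on[OF matrix_vector_mul_bounded_linear]
        continuous_on_diff continuous_on_id continuous_on_const)
  then have "(\<lambda>y. norm (B *v (y - x))) \<in> borel_measurable borel"
    by (rule borel_measurable_continuous_onI)
  then show ?thesis
    by (intro measurable_lebesgue_borel powr_real_measurable borel_measurable_const)
qed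

lemma kernel_upper_bound:
  fixes B :: "real ^ 'n ^ 'n"
  assumes "norm z \<le> \<Theta> * norm (B *v z)" "0 < \<Theta>" "0 < p"
  shows "1 / norm (B *v z) powr p \<le> \<Theta> powr p / norm z powr p"
proof (cases "z = 0")
  case False
  then have "0 < \<Theta> * norm (B *v z)" using assms(1) by (meson order_less_le_trans zero_less_norm_iff)
  then have "0 < norm (B *v z) powr p" "0 < norm z powr p"
    using False assms(2) by (auto simp: zero_less_mult_iff)
  moreover have "norm z powr p \<le> \<Theta> powr p * norm (B *v z) powr p"
    using powr_mono2[of p "norm z" "\<Theta> * norm (B *v z)"] assms by (simp add: powr_mult)
  ultimately show ?thesis by (simp add: field_simps)
qed simp

text \<open>Away from \<open>x\<close> the kernel decays like the weight of
  \<open>L_space s\<close>, which takes care of \<open>u\<close>; the constant \<open>c\<close>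
  needs integrability of the kernel itself at infinity, which holds as \<open>0 < s\<close>.\<close>

lemma L_space_integrable_off_ball:
  fixes u :: "real ^ 'n \<Rightarrow> real" and B :: "real ^ 'n ^ 'n"
  assumes u: "u \<in> L_space s" and s: "0 < s" and r: "0 < r" and \<Theta>: "0 < \<Theta>"
    and B: "\<And>z. norm z \<le> \<Theta> * norm (B *v z)"
  shows "integrable lebesgue
    (\<lambda>y. indicator (- ball x r) y * ((u y - c) / norm (B *v (y - x)) powr (real CARD('n) + 2 * s)))"
proof -
  define p where "p = real CARD('n) + 2 * s"
  have p: "p > 0" "real CARD('n) < p" using s by (auto simp: p_def intro: add_nonneg_pos)
  have um: "u \<in> borel_measurable lebesgue"
    and ui: "integrable lebesgue (\<lambda>x. \<bar>u x\<bar> / (1 + norm x powr p))"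
    using u by (auto simp: L_space_def p_def)
  \<comment> \<open>An integrable majorant of the inverse power on \<open>norm z \<ge> r\<close>.
    The radius may be below 1, so the part inside the unit ball is bounded by the constant
    \<open>1 / r powr p\<close>.\<close>
  define h where "h z = indicator (- ball 0 1) z * (1 / norm z powr p) + indicator (ball 0 1) z * (1 / r powr p)"
    for z :: "real ^ 'n"
  have "integrable lebesgue h"
    unfolding h_def using p integrable_power_at_infinity[where 'a = "real ^ 'n", of p]
    by (intro Bochner_Integration.integrable_add integrable_mult_left)
      (auto simp: integrable_real_indicator emeasure_ball less_top)
  then have hi: "integrable lebesgue (\<lambda>y. h (- x + y))"
    using lebesgue_translate(2)[of h "- x"] by (simp add: borel_measurable_integrable)
  \<comment> \<open>Chosen so that \<open>1 + norm y powr p \<le> C * norm z powr p\<close> for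
    \<open>z = y - x\<close> with \<open>norm z \<ge> r\<close>: the two summands bound
    \<open>1\<close> and \<open>norm y powr p\<close>, the latter through
    \<open>norm y \<le> (norm x / r + 1) * norm z\<close>.\<close>
  define C where "C = 1 / r powr p + (norm x / r + 1) powr p"
  show ?thesis unfolding p_def[symmetric]
  proof (rule Bochner_Integration.integrable_bound)
    show "integrable lebesgue (\<lambda>y. \<Theta> powr p * (C * (\<bar>u y\<bar> / (1 + norm y powr p)) + \<bar>c\<bar> * h (- x + y)))"
      using ui hi by (intro integrable_mult_right Bochner_Integration.integrable_add) auto
    have k: "(\<lambda>y. norm (B *v (y - x)) powr p) \<in> borel_measurable lebesgue"
      by (rule norm_matrix_powr_measurable)
    show "(\<lambda>y. indicator (- ball x r) y * ((u y - c) / norm (B *v (y - x)) powr p)) \<in> borel_measurable lebesgue"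
      using k um by (intro borel_measurable_times borel_measurable_divide borel_measurable_diff borel_measurable_indicator) auto
    show "AE y in lebesgue. norm (indicator (- ball x r) y * ((u y - c) / norm (B *v (y - x)) powr p))
        \<le> norm (\<Theta> powr p * (C * (\<bar>u y\<bar> / (1 + norm y powr p)) + \<bar>c\<bar> * h (- x + y)))"
    proof (intro AE_I2)
      fix y
      have C: "C > 0" using r by (auto simp: C_def intro!: add_pos_nonneg)
      have h0: "h z \<ge> 0" for z by (simp add: h_def)
      show "norm (indicator (- ball x r) y * ((u y - c) / norm (B *v (y - x)) powr p))
        \<le> norm (\<Theta> powr p * (C * (\<bar>u y\<bar> / (1 + norm y powr p)) + \<bar>c\<bar> * h (- x + y)))"
      proof (cases "y \<in> ball x r")
        case False
        define z where "z = y - x"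
        have z: "norm z \<ge> r" using False by (simp add: z_def dist_norm norm_minus_commute)
        then have z0: "norm z powr p > 0" using r by auto
        note B' = kernel_upper_bound[OF B \<Theta> p(1), of z]
        have "norm y \<le> norm z + norm x" using norm_triangle_ineq[of z x] by (simp add: z_def)
        also have "\<dots> \<le> (norm x / r + 1) * norm z"
        proof -
          have "norm x * r \<le> norm x * norm z" using z by (intro mult_left_mono) auto
          then show ?thesis using r by (simp add: field_simps)
        qed
        finally have "norm y powr p \<le> ((norm x / r + 1) * norm z) powr p"
          using p by (intro powr_mono2) auto
        also have "\<dots> = (norm x / r + 1) powr p * norm z powr p"
          using r by (intro powr_mult)
        finally have "norm y powr p \<le> (norm x / r + 1) powr p * norm z powr p" .
        moreover have "1 \<le> 1 / r powr p * norm z powr p"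
          using powr_mono2[of p r "norm z"] z r p by simp
        ultimately have "1 + norm y powr p \<le> C * norm z powr p"
          by (simp add: C_def algebra_simps)
        then have 1: "1 / norm z powr p \<le> C / (1 + norm y powr p)"
          using z0 by (simp add: field_simps add_pos_nonneg)
        have 2: "1 / norm z powr p \<le> h z"
          using powr_mono2[of p r "norm z"] z r p z0 by (auto simp: h_def intro!: divide_left_mono split: split_indicator)
        have "\<bar>u y - c\<bar> / norm (B *v z) powr p \<le> (\<bar>u y\<bar> + \<bar>c\<bar>) * (\<Theta> powr p * (1 / norm z powr p))"
          using mult_mono[of "\<bar>u y - c\<bar>" "\<bar>u y\<bar> + \<bar>c\<bar>", OF _ B'] by simp
        also have "\<dots> = \<Theta> powr p * (\<bar>u y\<bar> * (1 / norm z powr p) + \<bar>c\<bar> * (1 / norm z powr p))"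
          by (simp add: algebra_simps add_divide_distrib)
        also have "\<dots> \<le> \<Theta> powr p * (\<bar>u y\<bar> * (C / (1 + norm y powr p)) + \<bar>c\<bar> * h z)"
          using 1 2 by (intro mult_left_mono add_mono) auto
        finally have "\<bar>u y - c\<bar> / norm (B *v z) powr p \<le> \<dots>" .
        moreover have "0 \<le> \<Theta> powr p * (\<bar>u y\<bar> * (C / (1 + norm y powr p)) + \<bar>c\<bar> * h z)"
          using C h0 by (intro mult_nonneg_nonneg add_nonneg_nonneg divide_nonneg_nonneg) auto
        ultimately show ?thesis using False by (simp add: z_def mult_ac abs_divide)
      qed simp
    qed
  qed
qed

text \<open>Averaging over \<open>z\<close> and \<open>- z\<close> turns the truncated integral into that of a second difference,
  which is absolutely integrable.\<close>

lemma pv_truncation_converges: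
  fixes u :: "real ^ 'n \<Rightarrow> real"
  assumes u: "u \<in> L_space s" and s: "0 < s" "s < 1" and r: "0 < r" and \<Theta>: "0 < \<Theta>"
    and D: "\<And>z. norm z < r \<Longrightarrow> \<bar>u (x + z) + u (x - z) - 2 * u x\<bar> \<le> C * (norm z)\<^sup>2"
  obtains M where "\<And>B :: real ^ 'n ^ 'n. (\<And>z. norm z \<le> \<Theta> * norm (B *v z)) \<Longrightarrow>
    \<exists>l. \<bar>l\<bar> \<le> M \<and> ((\<lambda>\<epsilon>. LINT y:- ball x \<epsilon>|lebesgue.
      (u y - u x) / norm (B *v (y - x)) powr (real CARD('n) + 2 * s)) \<longlongrightarrow> l) (at_right 0)"
proof -
  define p where "p = real CARD('n) + 2 * s"
  have p: "p > 0" "real CARD('n) < p" "p < real CARD('n) + 2"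
    using s by (auto simp: p_def intro: add_nonneg_pos)
  define D where "D z = u (x + z) + u (x - z) - 2 * u x" for z
  have um: "u \<in> borel_measurable lebesgue"
    using u by (auto simp: L_space_def)
  have Dm: "D \<in> borel_measurable lebesgue"
    unfolding D_def using lebesgue_translate(1,4)[OF um, of x] by auto
  define F where "F B \<epsilon> y = indicator (- ball x \<epsilon>) y * ((u y - u x) / norm (B *v (y - x)) powr p)"
    for B :: "real ^ 'n ^ 'n" and \<epsilon> y
  have Fint: "integrable lebesgue (F B \<epsilon>)"
    "integrable lebesgue (\<lambda>z. F B \<epsilon> (x + z))" "integrable lebesgue (\<lambda>z. F B \<epsilon> (x - z))"
    "(LINT y|lebesgue. F B \<epsilon> y) = (LINT z|lebesgue. F B \<epsilon> (x + z))"
    "(LINT y|lebesgue. F B \<epsilon> y) = (LINT z|lebesgue. F B \<epsilon> (x - z))"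
    if "\<And>z. norm z \<le> \<Theta> * norm (B *v z)" "0 < \<epsilon>" "0 < \<Theta>" for B \<epsilon> \<Theta>
  proof -
    show F: "integrable lebesgue (F B \<epsilon>)"
      unfolding F_def p_def by (rule L_space_integrable_off_ball[OF u s(1) that(2,3,1)])
    note lebesgue_translate[OF borel_measurable_integrable[OF F], of x]
    with F show "integrable lebesgue (\<lambda>z. F B \<epsilon> (x + z))" "integrable lebesgue (\<lambda>z. F B \<epsilon> (x - z))"
      "(LINT y|lebesgue. F B \<epsilon> y) = (LINT z|lebesgue. F B \<epsilon> (x + z))"
      "(LINT y|lebesgue. F B \<epsilon> y) = (LINT z|lebesgue. F B \<epsilon> (x - z))" by simp_all
  qed
  have Fsum: "F B \<epsilon> (x + z) + F B \<epsilon> (x - z) = indicator (- ball 0 \<epsilon>) z * (D z / norm (B *v z) powr p)" for B \<epsilon> z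
  proof -
    have "norm (B *v (- z)) = norm (B *v z)"
      using matrix_vector_mult_diff_distrib[of B 0 z] by simp
    then show ?thesis
      by (auto simp: F_def D_def dist_norm add_divide_distrib[symmetric] split: split_indicator)
  qed
  \<comment> \<open>A majorant free of \<open>B\<close>, so its integral bounds the limits for all
    matrices at once.\<close>
  define S where "S z = \<bar>D z\<bar> / norm z powr p" for z
  have nm: "(\<lambda>z::real^'n. norm z powr p) \<in> borel_measurable lebesgue"
    by (intro measurable_lebesgue_borel) measurable
  have S: "integrable lebesgue S"
  proof (rule Bochner_Integration.integrable_bound)
    define r' where "r' = min r 1"
    have r': "0 < r'" "r' \<le> r" "r' \<le> 1" using r by (auto simp: r'_def)
    \<comment> \<open>Inside the ball of radius \<open>r'\<close> the second difference is
      quadratic. Outside it, \<open>S\<close> is the absolute value of the symmetrised truncated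
      integrand for the identity matrix, which is already integrable.\<close>
    let ?G = "\<lambda>z. \<bar>C\<bar> * (indicator (ball 0 1) z * ((norm z)\<^sup>2 / norm z powr p))
        + \<bar>F (mat 1) r' (x + z) + F (mat 1) r' (x - z)\<bar>"
    have "integrable lebesgue (\<lambda>z. F (mat 1) r' (x + z))" "integrable lebesgue (\<lambda>z. F (mat 1) r' (x - z))"
      using Fint(2,3)[of 1 "mat 1" r'] r' by simp_all
    then show "integrable lebesgue ?G"
      using p integrable_power_at_0[where 'a = "real ^ 'n", of p]
      by (intro Bochner_Integration.integrable_add integrable_mult_right integrable_abs) auto
    show "S \<in> borel_measurable lebesgue"
      unfolding S_def using Dm nm by auto
    show "AE z in lebesgue. norm (S z) \<le> norm (?G z)"
    proof (intro AE_I2)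
      fix z
      show "norm (S z) \<le> norm (?G z)"
      proof (cases "norm z < r'")
        case True
        then have "\<bar>D z\<bar> \<le> C * (norm z)\<^sup>2" using assms(6)[of z] r' by (simp add: D_def)
        also have "\<dots> \<le> \<bar>C\<bar> * (norm z)\<^sup>2" by (intro mult_right_mono) auto
        finally have "S z \<le> \<bar>C\<bar> * (norm z)\<^sup>2 / norm z powr p"
          unfolding S_def by (intro divide_right_mono) auto
        then show ?thesis using True r' by (auto simp: S_def Fsum)
      next
        case False
        then show ?thesis using r' by (simp add: S_def Fsum)
      qed
    qed
  qed
  show ?thesis
  proof (rule that[of "\<Theta> powr p * (LINT z|lebesgue. S z)"])
    fix B :: "real ^ 'n ^ 'n" assume B: "\<And>z. norm z \<le> \<Theta> * norm (B *v z)"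
    define G where "G z = (1 / 2) * (D z / norm (B *v z) powr p)" for z
    have km: "(\<lambda>y. norm (B *v y) powr p) \<in> borel_measurable lebesgue"
      using norm_matrix_powr_measurable[of B 0 p] by simp
    have Gm: "G \<in> borel_measurable lebesgue" unfolding G_def using Dm km by auto
    have GS: "\<bar>G z\<bar> \<le> \<Theta> powr p * S z" for z
    proof -
      have "\<bar>D z\<bar> * (1 / norm (B *v z) powr p) \<le> \<bar>D z\<bar> * (\<Theta> powr p / norm z powr p)"
        using kernel_upper_bound[OF B \<Theta> p(1), of z] by (intro mult_left_mono) auto
      moreover have "0 \<le> \<bar>D z\<bar> * (1 / norm (B *v z) powr p)" by simp
      moreover have "\<bar>G z\<bar> = (1 / 2) * (\<bar>D z\<bar> * (1 / norm (B *v z) powr p))"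
        by (simp add: G_def abs_mult)
      moreover have "\<Theta> powr p * S z = \<bar>D z\<bar> * (\<Theta> powr p / norm z powr p)"
        by (simp add: S_def)
      ultimately show ?thesis by linarith
    qed
    have GSi: "integrable lebesgue (\<lambda>z. \<Theta> powr p * S z)" using S by simp
    have Gi: "integrable lebesgue G"
      by (rule Bochner_Integration.integrable_bound[OF GSi Gm]) (use GS order_trans[OF GS abs_ge_self] in auto)
    have E: "(LINT y:- ball x \<epsilon>|lebesgue. (u y - u x) / norm (B *v (y - x)) powr p)
        = (LINT z|lebesgue. indicator (- ball 0 \<epsilon>) z * G z)" if "\<epsilon> > 0" for \<epsilon>
    proof -
      note F = Fint[OF B that \<Theta>]
      have "2 * (LINT y|lebesgue. F B \<epsilon> y) = (LINT z|lebesgue. F B \<epsilon> (x + z) + F B \<epsilon> (x - z))"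
        by (subst Bochner_Integration.integral_add[OF F(2,3)]) (simp add: F(4,5)[symmetric])
      also have "\<dots> = (LINT z|lebesgue. 2 * (indicator (- ball 0 \<epsilon>) z * G z))"
        by (simp add: Fsum G_def)
      finally show ?thesis
        by (simp add: set_lebesgue_integral_def F_def)
    qed
    \<comment> \<open>The cut-off radius is written as \<open>inverse t\<close>, so that dominated
      convergence along \<open>at_top\<close> applies. The origin, which every ball removes, does no
      harm since \<open>G 0 = 0\<close>.\<close>
    have "((\<lambda>t. LINT z|lebesgue. indicator (- ball 0 (inverse t)) z * G z) \<longlongrightarrow> (LINT z|lebesgue. G z)) at_top"
    proof (rule integral_dominated_convergence_at_top[OF Gm _ integrable_abs[OF Gi]])
      show "\<forall>\<^sub>F t in at_top. AE z in lebesgue. norm (indicator (- ball 0 (inverse t)) z * G z) \<le> \<bar>G z\<bar>"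
        by (auto intro!: always_eventually AE_I2 split: split_indicator)
      show "AE z in lebesgue. ((\<lambda>t. indicator (- ball 0 (inverse t)) z * G z) \<longlongrightarrow> G z) at_top"
      proof (intro AE_I2 tendsto_eventually)
        fix z
        show "\<forall>\<^sub>F t in at_top. indicator (- ball 0 (inverse t)) z * G z = G z"
        proof (cases "z = 0")
          case True
          then show ?thesis by (simp add: G_def)
        next
          case False
          show ?thesis
            using eventually_ge_at_top[of "inverse (norm z)"]
          proof eventually_elim
            case (elim t)
            then have "inverse t \<le> norm z"
              using False by (metis inverse_inverse_eq le_imp_inverse_le positive_imp_inverse_positive zero_less_norm_iff)
            then show ?case by simp
          qed
        qed
      qed
      show "(\<lambda>z. indicator (- ball 0 (inverse t)) z * G z) \<in> borel_measurable lebesgue" for t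
        using Gm by (intro borel_measurable_times borel_measurable_indicator) auto
    qed
    then have lim: "((\<lambda>\<epsilon>. LINT z|lebesgue. indicator (- ball 0 \<epsilon>) z * G z) \<longlongrightarrow> (LINT z|lebesgue. G z)) (at_right 0)"
      by (simp add: filterlim_at_right_to_top)
    have "((\<lambda>\<epsilon>. LINT y:- ball x \<epsilon>|lebesgue. (u y - u x) / norm (B *v (y - x)) powr p) \<longlongrightarrow> (LINT z|lebesgue. G z)) (at_right 0)"
      by (rule Lim_transform_eventually[OF lim])
        (auto simp: E eventually_at_right_field intro!: exI[of _ 1])
    moreover have "\<bar>LINT z|lebesgue. G z\<bar> \<le> \<Theta> powr p * (LINT z|lebesgue. S z)"
    proof -
      have "\<bar>LINT z|lebesgue. G z\<bar> \<le> (LINT z|lebesgue. \<bar>G z\<bar>)"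
        by (rule integral_abs_bound)
      also have "\<dots> \<le> (LINT z|lebesgue. \<Theta> powr p * S z)"
        using Gi GSi GS by (intro integral_mono) auto
      finally show ?thesis by simp
    qed
    ultimately show "\<exists>l. \<bar>l\<bar> \<le> \<Theta> powr p * (LINT z|lebesgue. S z) \<and> ((\<lambda>\<epsilon>. LINT y:- ball x \<epsilon>|lebesgue.
      (u y - u x) / norm (B *v (y - x)) powr (real CARD('n) + 2 * s)) \<longlongrightarrow> l) (at_right 0)"
      unfolding p_def by blast
  qed
qed

section \<open>Reflection in a hyperplane\<close>

definition hyper_refl :: "'n \<Rightarrow> real \<Rightarrow> real ^ 'n \<Rightarrow> real ^ ('n::finite)" where
  "hyper_refl k \<mu> y = y + (2 * (\<mu> - y $ k)) *\<^sub>R axis k 1"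

lemma hyper_refl_nth: "hyper_refl k \<mu> y $ k = 2 * \<mu> - y $ k"
  by (simp add: hyper_refl_def)

lemma hyper_refl_hyper_refl [simp]: "hyper_refl k \<mu> (hyper_refl k \<mu> y) = y"
  by (simp add: hyper_refl_def vec_eq_iff axis_def algebra_simps)

text \<open>The linear part of the reflection is written as a shift along the axis, the form in
  which \<open>admissible_shift\<close> yields invariance of the kernel.\<close>

lemma hyper_refl_diff:
  "hyper_refl k \<mu> y - hyper_refl k \<mu> x = (y - x) + (- 2 * (y - x) $ k) *\<^sub>R axis k 1"
  by (simp add: hyper_refl_def vec_eq_iff axis_def algebra_simps)

lemma dist_hyper_refl: "dist (hyper_refl k \<mu> x) (hyper_refl k \<mu> y) = dist x y"
proof -
  define z where "z = x - y"
  have "(norm (z + (- 2 * z $ k) *\<^sub>R axis k 1))\<^sup>2 = (norm z)\<^sup>2"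
    unfolding power2_norm_eq_inner
    by (simp add: inner_diff_left inner_diff_right inner_axis inner_axis_axis inner_commute[of "axis k 1" z])
  then have "norm (z + (- 2 * z $ k) *\<^sub>R axis k 1) = norm z"
    using power2_eq_iff_nonneg[of "norm (z + (- 2 * z $ k) *\<^sub>R axis k 1)" "norm z"] by simp
  then show ?thesis
    by (simp only: dist_norm hyper_refl_diff z_def)
qed

lemma lebesgue_hyper_refl:
  fixes f :: "real ^ 'n \<Rightarrow> real"
  assumes f: "f \<in> borel_measurable lebesgue"
  shows "(\<lambda>x. f (hyper_refl k \<mu> x)) \<in> borel_measurable lebesgue"
    and "integrable lebesgue (\<lambda>x. f (hyper_refl k \<mu> x)) \<longleftrightarrow> integrable lebesgue f"
    and "(LINT x|lebesgue. f (hyper_refl k \<mu> x)) = (LINT x|lebesgue. f x)"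
proof -
  define c where "c j = (if j = axis k 1 then -1 else 1 :: real)" for j :: "real ^ 'n"
  have e: "axis k (1::real) \<in> Basis" by (simp add: axis_in_Basis_iff)
  have "(2 * \<mu>) *\<^sub>R axis k 1 + (\<Sum>j\<in>Basis. (c j * (x \<bullet> j)) *\<^sub>R j) = hyper_refl k \<mu> x" for x
  proof -
    have "(\<Sum>j\<in>Basis. (c j * (x \<bullet> j)) *\<^sub>R j)
        = (\<Sum>j\<in>Basis. (x \<bullet> j) *\<^sub>R j + (if j = axis k 1 then (- 2 * (x \<bullet> j)) *\<^sub>R j else 0))"
      by (rule sum.cong) (auto simp: c_def algebra_simps scaleR_2 mult.commute simp flip: scaleR_add_left)
    also have "\<dots> = x + (- 2 * x $ k) *\<^sub>R axis k 1"
      using e by (simp add: sum.distrib euclidean_representation inner_axis)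
    finally show ?thesis
      by (simp add: hyper_refl_def algebra_simps)
  qed
  then show "(\<lambda>x. f (hyper_refl k \<mu> x)) \<in> borel_measurable lebesgue"
    and "integrable lebesgue (\<lambda>x. f (hyper_refl k \<mu> x)) \<longleftrightarrow> integrable lebesgue f"
    and "(LINT x|lebesgue. f (hyper_refl k \<mu> x)) = (LINT x|lebesgue. f x)"
    using lebesgue_signed_translation[OF _ f, of c "(2 * \<mu>) *\<^sub>R axis k 1"] by (simp_all add: c_def)
qed

text \<open>The quotient of the two powers is at most
  \<open>(a\<^sup>2 / (a\<^sup>2 + g)) powr (p / 2)\<close>, which increases with \<open>a\<close>;
  replacing \<open>a\<close> by \<open>L\<close> gives a gap that depends only on \<open>L\<close>,
  \<open>g\<close> and \<open>p\<close>. Here \<open>a\<close> and \<open>b\<close> will be the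
  \<open>B\<close>-norms from \<open>x\<close> to a point and to its mirror image.\<close>

lemma kernel_gap:
  fixes a b L g p :: real
  assumes "0 < a" "a \<le> L" "0 < g" "a\<^sup>2 + g \<le> b\<^sup>2" "0 < p" "0 \<le> b"
  shows "1 / L powr p * (1 - (L\<^sup>2 / (L\<^sup>2 + g)) powr (p / 2)) \<le> 1 / a powr p - 1 / b powr p"
proof -
  have b: "b > 0" using assms by (metis add_pos_pos less_eq_real_def not_less power_zero_numeral zero_less_power)
  have L: "L > 0" using assms by simp
  have "a\<^sup>2 * g \<le> L\<^sup>2 * g" using assms by (intro mult_right_mono power_mono) auto
  then have "a\<^sup>2 / (a\<^sup>2 + g) \<le> L\<^sup>2 / (L\<^sup>2 + g)"
    using assms by (simp add: divide_simps add_pos_pos algebra_simps)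
  moreover have "a\<^sup>2 / b\<^sup>2 \<le> a\<^sup>2 / (a\<^sup>2 + g)"
    using assms b by (intro divide_left_mono mult_pos_pos add_pos_pos) auto
  ultimately have "(a\<^sup>2 / b\<^sup>2) powr (p / 2) \<le> (L\<^sup>2 / (L\<^sup>2 + g)) powr (p / 2)"
    using assms by (intro powr_mono2) auto
  moreover have "(a\<^sup>2 / b\<^sup>2) powr (p / 2) = a powr p / b powr p"
  proof -
    have "c\<^sup>2 powr (p / 2) = c powr p" if "0 < c" for c :: real
      using that powr_powr[of c 2 "p / 2"] by simp
    then show ?thesis using assms(1) b by (simp add: powr_divide)
  qed
  ultimately have 1: "1 - (L\<^sup>2 / (L\<^sup>2 + g)) powr (p / 2) \<le> 1 - a powr p / b powr p"
    by simp
  have 0: "0 \<le> 1 - (L\<^sup>2 / (L\<^sup>2 + g)) powr (p / 2)"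
    using assms L by (simp add: powr_le1 add_pos_pos)
  have "1 / L powr p \<le> 1 / a powr p"
    using assms by (intro divide_left_mono powr_mono2 mult_pos_pos) auto
  from mult_mono[OF this 1 _ 0] have "1 / L powr p * (1 - (L\<^sup>2 / (L\<^sup>2 + g)) powr (p / 2))
      \<le> 1 / a powr p * (1 - a powr p / b powr p)" by simp
  also have "\<dots> = 1 / a powr p - 1 / b powr p"
    using assms(1) by (simp add: right_diff_distrib)
  finally show ?thesis .
qed

text \<open>The difference of the truncated integrals is the integral of
  \<open>F y = (w y - w x) / N (y - x)\<close> off \<open>ball x \<epsilon>\<close>; as \<open>w\<close> is odd under the reflection \<open>R\<close>, it is
  bounded below pointwise through \<open>F y + F (R y)\<close>. The ball around \<open>y0\<close> contributes \<open>\<delta>\<close>, the ball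
  \<open>ball x d\<close> the power of \<open>d\<close>. \<open>\<delta>\<close> must not depend on \<open>B\<close>, to survive the infimum.\<close>

lemma truncated_reflection_gap:
  fixes u :: "real ^ 'n \<Rightarrow> real" and x y0 :: "real ^ 'n" and k :: 'n and s \<mu> :: real
  defines "p \<equiv> real CARD('n) + 2 * s"
  defines "w \<equiv> \<lambda>y. u (hyper_refl k \<mu> y) - u y"
  defines "d \<equiv> \<mu> - x $ k"
  assumes u: "u \<in> L_space s" and s: "0 < s" and \<theta>: "0 < \<theta>" "0 < \<Theta>"
    and d: "0 < d" and m: "w x \<le> 0"
    and min: "\<And>y. y $ k < \<mu> \<Longrightarrow> w x \<le> w y"
    and cont: "isCont w x"
    and \<rho>: "0 < \<rho>" "\<rho> < dist x y0" and \<gamma>: "0 < \<gamma>" and c0: "0 < c0"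
    and U: "\<And>y. y \<in> ball y0 \<rho> \<Longrightarrow> y $ k \<le> \<mu> - \<gamma> \<and> c0 \<le> w y - w x"
  obtains \<delta> where "0 < \<delta>"
    "\<And>B :: real ^ 'n ^ 'n. \<lbrakk>\<And>z. norm z \<le> \<Theta> * norm (B *v z); \<And>z. \<theta> * norm (B *v z) \<le> norm z;
        \<exists>\<beta>\<ge>1 / \<Theta>. \<forall>z \<tau>. (norm (B *v (z + \<tau> *\<^sub>R axis k 1)))\<^sup>2
          = (norm (B *v z))\<^sup>2 + \<beta>\<^sup>2 * (2 * \<tau> * z $ k + \<tau>\<^sup>2)\<rbrakk> \<Longrightarrow>
      \<forall>\<^sub>F \<epsilon> in at_right 0.
        \<delta> + (- w x) * (2 * unit_ball_vol (real CARD('n)) * (\<theta> / 3) powr p) * d powr (- 2 * s)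
        \<le> (LINT y:- ball (hyper_refl k \<mu> x) \<epsilon>|lebesgue.
              (u y - u (hyper_refl k \<mu> x)) / norm (B *v (y - hyper_refl k \<mu> x)) powr p)
          - (LINT y:- ball x \<epsilon>|lebesgue. (u y - u x) / norm (B *v (y - x)) powr p)"
proof -
  define R where "R = hyper_refl k \<mu>"
  define m where "m = w x"
  have p: "p > 0" using s by (auto simp: p_def intro: add_nonneg_pos)
  \<comment> \<open>On \<open>ball y0 \<rho>\<close>, \<open>L\<close> bounds
    \<open>norm (B *v (y - x))\<close>, and \<open>g\<close> bounds from below the increase of its
    square under reflection, as \<open>\<beta> \<ge> 1 / \<Theta>\<close> and \<open>y\<close> is at
    least \<open>\<gamma>\<close> below the plane.\<close>
  define L where "L = (dist x y0 + \<rho>) / \<theta>"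
  define g where "g = 4 * \<gamma> * d / \<Theta>\<^sup>2"
  define \<kappa> where "\<kappa> = 1 / L powr p * (1 - (L\<^sup>2 / (L\<^sup>2 + g)) powr (p / 2))"
  define c1 where "c1 = c0 * \<kappa>"
  define c2 where "c2 = (\<theta> / (3 * d)) powr p"
  define V where "V = measure lborel (ball x d)"
  define W where "W = measure lborel (ball y0 \<rho>)"
  \<comment> \<open>The loss \<open>e\<close>, charged on all of \<open>ball x d\<close>, costs
    \<open>e * V\<close>, exactly half of the gain \<open>c1 * W\<close>. The tolerance
    \<open>\<eta>\<close> is such that \<open>\<eta> * k2 y \<le> e\<close> there, since
    \<open>k2\<close> is at most \<open>(\<Theta> / d) powr p\<close> on that ball.\<close>
  define e where "e = c1 * W / (2 * V)"
  define \<eta> where "\<eta> = e * d powr p / \<Theta> powr p"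
  have g: "g > 0" using \<gamma> d \<theta> by (simp add: g_def)
  have L: "L > 0" using \<rho> \<theta> unfolding L_def by (intro divide_pos_pos add_pos_pos) auto
  have "L\<^sup>2 / (L\<^sup>2 + g) < 1"
    using g by (subst divide_less_eq_1_pos) (auto intro: add_nonneg_pos)
  then have "(L\<^sup>2 / (L\<^sup>2 + g)) powr (p / 2) < 1 powr (p / 2)"
    using g p by (intro powr_less_mono2) auto
  then have \<kappa>: "\<kappa> > 0" using L by (simp add: \<kappa>_def)
  then have c1: "c1 > 0" using c0 by (simp add: c1_def)
  have VW: "V > 0" "W > 0" using d \<rho> by (auto simp: V_def W_def)
  have e: "e > 0" using c1 VW by (simp add: e_def)
  have \<eta>: "\<eta> > 0" using e d \<theta> by (simp add: \<eta>_def)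
  have m0: "m \<le> 0" using m by (simp add: m_def)
  have Rk: "R y $ k = 2 * \<mu> - y $ k" for y by (simp add: R_def hyper_refl_nth)
  have RR: "R (R y) = y" for y by (simp add: R_def)
  have wR: "w (R y) = - w y" for y by (simp add: w_def R_def)
  have comp: "y $ k - x $ k \<le> dist x y" for y :: "real ^ 'n"
    using component_le_norm_cart[of "y - x" k] by (simp add: dist_norm norm_minus_commute)
  obtain \<epsilon>0 where \<epsilon>0: "\<epsilon>0 > 0" "\<And>y. dist x y < \<epsilon>0 \<Longrightarrow> \<bar>w y - m\<bar> \<le> \<eta>"
  proof -
    obtain \<epsilon>0 where "\<epsilon>0 > 0" "\<forall>y. dist y x < \<epsilon>0 \<longrightarrow> dist (w y) (w x) < \<eta>"
      using cont \<eta> unfolding continuous_at_eps_delta by blast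
    then show ?thesis using that[of \<epsilon>0] by (auto simp: m_def dist_real_def dist_commute intro: less_imp_le)
  qed
  \<comment> \<open>The removed ball must lie where \<open>w\<close> is \<open>\<eta>\<close>-close
    to \<open>m\<close>, inside \<open>ball x d\<close> and off
    \<open>ball y0 \<rho>\<close>.\<close>
  define \<epsilon>1 where "\<epsilon>1 = min \<epsilon>0 (min d (dist x y0 - \<rho>))"
  have \<epsilon>1: "\<epsilon>1 > 0" using \<epsilon>0 d \<rho> by (simp add: \<epsilon>1_def)
  show ?thesis
  proof (rule that[of "c1 * W / 2"])
    show "0 < c1 * W / 2" using c1 VW by simp
    fix B :: "real ^ 'n ^ 'n"
    assume Blo: "\<And>z. norm z \<le> \<Theta> * norm (B *v z)" and Bup: "\<And>z. \<theta> * norm (B *v z) \<le> norm z"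
    assume "\<exists>\<beta>\<ge>1 / \<Theta>. \<forall>z \<tau>. (norm (B *v (z + \<tau> *\<^sub>R axis k 1)))\<^sup>2
          = (norm (B *v z))\<^sup>2 + \<beta>\<^sup>2 * (2 * \<tau> * z $ k + \<tau>\<^sup>2)"
    then obtain \<beta> where \<beta>: "\<beta> \<ge> 1 / \<Theta>"
      and shift: "\<And>z \<tau>. (norm (B *v (z + \<tau> *\<^sub>R axis k 1)))\<^sup>2
          = (norm (B *v z))\<^sup>2 + \<beta>\<^sup>2 * (2 * \<tau> * z $ k + \<tau>\<^sup>2)" by blast
    have Bpos: "norm (B *v z) > 0" if "z \<noteq> 0" for z
      using Blo[of z] that \<theta> by (metis mult_zero_right norm_ge_zero norm_le_zero_iff order_le_less)
    have NR: "norm (B *v (R y - R x)) = norm (B *v (y - x))" for y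
    proof -
      have "(norm (B *v (R y - R x)))\<^sup>2 = (norm (B *v (y - x)))\<^sup>2"
        unfolding R_def hyper_refl_diff shift by (simp add: power2_eq_square algebra_simps)
      then show ?thesis by (simp add: power2_eq_iff_nonneg)
    qed
    have gap2: "(norm (B *v (R y - x)))\<^sup>2 = (norm (B *v (y - x)))\<^sup>2 + \<beta>\<^sup>2 * (4 * (\<mu> - y $ k) * d)" for y
    proof -
      have "R y - x = (y - x) + (2 * (\<mu> - y $ k)) *\<^sub>R axis k 1"
        by (simp add: R_def hyper_refl_def)
      then have "(norm (B *v (R y - x)))\<^sup>2 = (norm (B *v (y - x)))\<^sup>2
          + \<beta>\<^sup>2 * (2 * (2 * (\<mu> - y $ k)) * (y - x) $ k + (2 * (\<mu> - y $ k))\<^sup>2)"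
        by (simp only: shift)
      then show ?thesis by (simp add: d_def power2_eq_square algebra_simps)
    qed
    have "(1 / \<Theta>)\<^sup>2 \<le> \<beta>\<^sup>2" using \<beta> \<theta> by (intro power_mono) auto
    then have \<beta>2: "1 / \<Theta>\<^sup>2 \<le> \<beta>\<^sup>2" by (simp add: power_divide)
    have gap: "(norm (B *v (y - x)))\<^sup>2 + (4 * (\<mu> - y $ k) * d) / \<Theta>\<^sup>2 \<le> (norm (B *v (R y - x)))\<^sup>2"
      if "y $ k \<le> \<mu>" for y
      using mult_right_mono[OF \<beta>2, of "4 * (\<mu> - y $ k) * d"] that d by (simp add: gap2)
    define k1 where "k1 y = 1 / norm (B *v (y - x)) powr p" for y
    define k2 where "k2 y = 1 / norm (B *v (R y - x)) powr p" for y
    have k12: "k2 y \<le> k1 y" if "y \<noteq> x" "y $ k \<le> \<mu>" for y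
    proof -
      have "(norm (B *v (y - x)))\<^sup>2 \<le> (norm (B *v (R y - x)))\<^sup>2"
        using gap[OF that(2)] that(2) d by (smt (verit) divide_nonneg_nonneg mult_nonneg_nonneg zero_le_power2)
      then have "norm (B *v (y - x)) \<le> norm (B *v (R y - x))"
        by (rule power2_le_imp_le) simp
      then show ?thesis
        unfolding k1_def k2_def using Bpos[of "y - x"] that p
        by (intro divide_left_mono powr_mono2 mult_pos_pos) (auto intro: order_less_le_trans)
    qed
    have k1U: "\<kappa> \<le> k1 y - k2 y" if "y \<in> ball y0 \<rho>" for y
      unfolding k1_def k2_def \<kappa>_def
    proof (rule kernel_gap)
      have "dist x y \<noteq> 0" using that \<rho> by (auto simp: dist_commute)
      then show "0 < norm (B *v (y - x))" using Bpos[of "y - x"] by auto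
      have "norm (y - x) \<le> dist x y0 + \<rho>"
        using that dist_triangle[of x y y0] by (simp add: dist_norm norm_minus_commute)
      then show "norm (B *v (y - x)) \<le> L"
        using Bup[of "y - x"] \<theta> by (simp add: L_def field_simps)
      have yk: "y $ k \<le> \<mu> - \<gamma>" using U[OF that] by simp
      then have "g \<le> (4 * (\<mu> - y $ k) * d) / \<Theta>\<^sup>2"
        unfolding g_def using d by (intro divide_right_mono mult_right_mono) auto
      then show "(norm (B *v (y - x)))\<^sup>2 + g \<le> (norm (B *v (R y - x)))\<^sup>2"
        using gap[of y] yk \<gamma> by simp
    qed (use g p in auto)
    have RV: "norm (R y - x) \<le> 3 * d" if "y \<in> ball x d" for y
    proof -
      have "norm (R y - x) \<le> dist (R y) (R x) + dist (R x) x"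
        using dist_triangle[of "R y" x "R x"] by (simp add: dist_norm)
      also have "dist (R y) (R x) = dist y x" by (simp add: R_def dist_hyper_refl)
      also have "dist (R x) x = 2 * d" using d by (simp add: R_def hyper_refl_def dist_norm d_def)
      finally show ?thesis using that by (simp add: dist_commute)
    qed
    have k2V: "c2 \<le> k2 y" if "y \<in> ball x d" for y
    proof -
      have "R y $ k - x $ k > 0"
        using comp[of y] that d by (simp add: Rk d_def)
      then have "R y \<noteq> x" by auto
      then have N: "0 < norm (B *v (R y - x))" using Bpos by simp
      have "norm (B *v (R y - x)) \<le> 3 * d / \<theta>"
        using Bup[of "R y - x"] RV[OF that] \<theta> by (simp add: field_simps)
      then have "norm (B *v (R y - x)) powr p \<le> (3 * d / \<theta>) powr p"
        using p by (intro powr_mono2) auto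
      then have "1 / (3 * d / \<theta>) powr p \<le> k2 y"
        unfolding k2_def using N d \<theta> by (intro divide_left_mono mult_pos_pos) auto
      moreover have "1 / (3 * d / \<theta>) powr p = c2"
        using d \<theta> by (simp add: c2_def powr_divide)
      ultimately show ?thesis by simp
    qed
    have k2B: "\<eta> * k2 y \<le> e" if "y \<in> ball x d" for y
    proof -
      have "d \<le> norm (R y - x)"
        using comp[of y] comp[of "R y"] that d by (simp add: Rk d_def dist_norm norm_minus_commute)
      then have "d powr p \<le> norm (R y - x) powr p" using d p by (intro powr_mono2) auto
      moreover have "k2 y \<le> \<Theta> powr p / norm (R y - x) powr p"
        unfolding k2_def by (rule kernel_upper_bound[OF Blo \<theta>(2) p])
      moreover have "\<Theta> powr p / norm (R y - x) powr p \<le> \<Theta> powr p / d powr p"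
        using calculation(1) d by (intro divide_left_mono mult_pos_pos) (auto intro: order_less_le_trans)
      ultimately have "\<eta> * k2 y \<le> \<eta> * (\<Theta> powr p / d powr p)"
        using \<eta> by (intro mult_left_mono) auto
      also have "\<dots> = e" using d \<theta> by (simp add: \<eta>_def)
      finally show ?thesis .
    qed
    have main: "\<delta>' \<le> (LINT y:- ball (R x) \<epsilon>|lebesgue. (u y - u (R x)) / norm (B *v (y - R x)) powr p)
          - (LINT y:- ball x \<epsilon>|lebesgue. (u y - u x) / norm (B *v (y - x)) powr p)"
      if \<epsilon>: "0 < \<epsilon>" "\<epsilon> < \<epsilon>1" and \<delta>': "\<delta>' = c1 * W / 2 + (- 2 * m * c2) * V" for \<epsilon> \<delta>'
    proof -
      define g1 where "g1 y = indicator (- ball x \<epsilon>) y * ((u y - u x) / norm (B *v (y - x)) powr p)" for y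
      define g2 where "g2 y = indicator (- ball (R x) \<epsilon>) y * ((u y - u (R x)) / norm (B *v (y - R x)) powr p)" for y
      define F where "F y = indicator (- ball x \<epsilon>) y * ((w y - m) * k1 y)" for y
      \<comment> \<open>The pointwise minorant. Its term \<open>- e\<close> is spread over
        \<open>ball x d\<close> instead of the removed ball, so that \<open>Q\<close> does not
        depend on \<open>\<epsilon>\<close>.\<close>
      define Q where "Q y = c1 * indicator (ball y0 \<rho>) y + (- 2 * m * c2 - e) * indicator (ball x d) y" for y
      have g1i: "integrable lebesgue g1" and g2i: "integrable lebesgue g2"
        unfolding g1_def g2_def p_def by (rule L_space_integrable_off_ball[OF u s \<epsilon>(1) \<theta>(2) Blo])+
      note g2R = lebesgue_hyper_refl[OF borel_measurable_integrable[OF g2i], of k \<mu>, folded R_def]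
      have Feq: "F y = g2 (R y) - g1 y" for y
      proof -
        have "dist (R x) (R y) = dist x y" by (simp add: R_def dist_hyper_refl)
        then show ?thesis
          by (auto simp: F_def g1_def g2_def NR k1_def m_def w_def R_def[symmetric] diff_divide_distrib[symmetric]
              split: split_indicator)
      qed
      have Fi: "integrable lebesgue F"
        unfolding Feq using g2R g2i g1i by auto
      have FI: "(LINT y|lebesgue. F y) = (LINT y|lebesgue. g2 y) - (LINT y|lebesgue. g1 y)"
        unfolding Feq using g2R g2i g1i by simp
      note FR = lebesgue_hyper_refl[OF borel_measurable_integrable[OF Fi], of k \<mu>, folded R_def]
      have bi: "integrable lebesgue (indicator (ball a r) :: real ^ 'n \<Rightarrow> real)" for a r
        using emeasure_lborel_ball_finite[of a r] by (intro integrable_real_indicator) auto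
      have Qi: "integrable lebesgue Q"
        unfolding Q_def by (intro Bochner_Integration.integrable_add integrable_mult_right bi)
      note QR = lebesgue_hyper_refl[OF borel_measurable_integrable[OF Qi], of k \<mu>, folded R_def]
      have QI: "(LINT y|lebesgue. Q y) = \<delta>'"
      proof -
        have "(LINT y|lebesgue. Q y) = c1 * W + (- 2 * m * c2 - e) * V"
          unfolding Q_def
          by (subst Bochner_Integration.integral_add) (auto intro!: integrable_mult_right bi simp: V_def W_def)
        also have "e * V = c1 * W / 2" using VW by (simp add: e_def)
        then have "c1 * W + (- 2 * m * c2 - e) * V = \<delta>'"
          by (simp add: \<delta>' algebra_simps)
        finally show ?thesis .
      qed
      have Q0: "Q y = 0" if "\<mu> \<le> y $ k" for y
      proof -
        have "y \<notin> ball y0 \<rho>" using U[of y] that \<gamma> by auto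
        moreover have "y \<notin> ball x d" using comp[of y] that by (simp add: d_def)
        ultimately show ?thesis by (simp add: Q_def)
      qed
      \<comment> \<open>Oddness of \<open>w\<close> gives
        \<open>F y + F (R y) = (w y - m) * (k1 y - k2 y) - 2 * m * k2 y\<close> off the removed
        ball: the first product yields the gain on \<open>ball y0 \<rho>\<close>, the second the
        gain on \<open>ball x d\<close>.\<close>
      have half: "Q y \<le> F y + F (R y)" if y: "y $ k < \<mu>" for y
      proof -
        have h0: "0 \<le> w y - m" using min[OF y] by (simp add: m_def)
        have "R y \<notin> ball x \<epsilon>"
          using comp[of "R y"] y \<epsilon> by (simp add: Rk d_def \<epsilon>1_def)
        then have FRy: "F (R y) = (- (w y - m) - 2 * m) * k2 y"
          by (simp add: F_def wR k1_def k2_def)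
        have k2p: "0 \<le> k2 y" by (simp add: k2_def)
        have A: "(- 2 * m * c2) * indicator (ball x d) y \<le> (- 2 * m) * k2 y"
          using k2V[of y] m0 k2p mult_left_mono[of c2 "k2 y" "- 2 * m"]
          by (auto split: split_indicator simp: mult_le_0_iff)
        show ?thesis
        proof (cases "y \<in> ball x \<epsilon>")
          case False
          then have yx: "y \<noteq> x" using \<epsilon> by auto
          have "F y + F (R y) = (w y - m) * (k1 y - k2 y) + (- 2 * m) * k2 y"
            using False by (simp add: FRy) (simp add: F_def algebra_simps)
          moreover have "c1 * indicator (ball y0 \<rho>) y \<le> (w y - m) * (k1 y - k2 y)"
          proof (cases "y \<in> ball y0 \<rho>")
            case True
            then show ?thesis
              using U[OF True] k1U[OF True] \<kappa> c0 mult_mono[of c0 "w y - m" \<kappa> "k1 y - k2 y"]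
              by (simp add: c1_def m_def)
          next
            case False
            then show ?thesis using h0 k12[OF yx] y by simp
          qed
          moreover have "Q y \<le> c1 * indicator (ball y0 \<rho>) y + (- 2 * m * c2) * indicator (ball x d) y"
            using e by (simp add: Q_def split: split_indicator)
          ultimately show ?thesis using A by linarith
        next
          \<comment> \<open>Here only \<open>F (R y)\<close> survives, with the negative term
            \<open>- (w y - m) * k2 y\<close>; continuity of \<open>w\<close> keeps it above
            \<open>- e\<close>.\<close>
          case True
          then have d1: "dist x y < \<epsilon>0" "y \<in> ball x d" "dist x y < dist x y0 - \<rho>"
            using \<epsilon> by (auto simp: \<epsilon>1_def)
          have "y \<notin> ball y0 \<rho>"
            using d1(3) dist_triangle[of x y0 y] by (simp add: dist_commute)
          then have "Q y = - 2 * m * c2 - e" using d1 by (simp add: Q_def)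
          moreover have "F y = 0" using True by (simp add: F_def)
          moreover have "(w y - m) * k2 y \<le> \<eta> * k2 y"
            using \<epsilon>0(2)[OF d1(1)] k2p by (intro mult_right_mono) auto
          ultimately show ?thesis
            using k2B[OF d1(2)] A d1(2) by (simp add: FRy algebra_simps)
        qed
      qed
      \<comment> \<open>Symmetrising extends the bound to the whole space, because \<open>Q\<close>
        vanishes on the far side and \<open>w\<close> on the plane; integrating counts both sides
        twice, so the factor 2 cancels.\<close>
      have all: "Q y + Q (R y) \<le> F y + F (R y)" for y
      proof (cases "y $ k" \<mu> rule: linorder_cases)
        case less
        then show ?thesis using half[OF less] Q0[of "R y"] by (simp add: Rk)
      next
        case equal
        then have Ry: "R y = y" by (simp add: R_def hyper_refl_def)
        then have "w y = 0" by (simp add: w_def R_def)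
        then have "F y \<ge> 0"
          using m0 by (auto simp: F_def k1_def intro!: divide_nonpos_nonneg split: split_indicator)
        then show ?thesis using Q0[of y] equal by (simp add: Ry)
      next
        case greater
        then show ?thesis using half[of "R y"] Q0[of y] by (simp add: Rk RR)
      qed
      have "(LINT y|lebesgue. Q y + Q (R y)) \<le> (LINT y|lebesgue. F y + F (R y))"
        using all Qi QR Fi FR by (intro integral_mono) auto
      then have "\<delta>' \<le> (LINT y|lebesgue. F y)"
        using Qi QR Fi FR QI by simp
      then show ?thesis
        unfolding FI by (simp add: set_lebesgue_integral_def g1_def[abs_def] g2_def[abs_def])
    qed
    have eq: "c1 * W / 2 + (- 2 * m * c2) * V
        = c1 * W / 2 + (- w x) * (2 * unit_ball_vol (real CARD('n)) * (\<theta> / 3) powr p) * d powr (- 2 * s)"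
    proof -
      have "V = unit_ball_vol (real CARD('n)) * d powr real CARD('n)"
        using d by (simp add: V_def content_ball powr_realpow)
      moreover have "c2 = (\<theta> / 3) powr p * d powr (- p)"
        using d \<theta> by (simp add: c2_def powr_minus powr_divide powr_mult divide_simps)
      moreover have "d powr (- p) * d powr real CARD('n) = d powr (- 2 * s)"
        by (simp add: powr_add[symmetric] p_def)
      ultimately have "c2 * V = unit_ball_vol (real CARD('n)) * (\<theta> / 3) powr p * d powr (- 2 * s)"
        by (metis mult.assoc mult.left_commute)
      then show ?thesis by (simp add: m_def mult.assoc)
    qed
    show "\<forall>\<^sub>F \<epsilon> in at_right 0.
        c1 * W / 2 + (- w x) * (2 * unit_ball_vol (real CARD('n)) * (\<theta> / 3) powr p) * d powr (- 2 * s)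
        \<le> (LINT y:- ball (hyper_refl k \<mu> x) \<epsilon>|lebesgue.
              (u y - u (hyper_refl k \<mu> x)) / norm (B *v (y - hyper_refl k \<mu> x)) powr p)
          - (LINT y:- ball x \<epsilon>|lebesgue. (u y - u x) / norm (B *v (y - x)) powr p)"
      unfolding eventually_at_right_field R_def[symmetric] using \<epsilon>1
      by (intro exI[of _ \<epsilon>1] conjI allI impI main eq[symmetric]) auto
  qed
qed

section \<open>From truncated integrals to the operator \<open>Fs\<close>\<close>

lemma C11_loc_second_difference:
  fixes u :: "'a::euclidean_space \<Rightarrow> real"
  assumes u: "u \<in> C11_loc \<Omega>" and \<Omega>: "open \<Omega>" "x \<in> \<Omega>"
  obtains r C where "0 < r" "\<And>z. norm z < r \<Longrightarrow> \<bar>u (x + z) + u (x - z) - 2 * u x\<bar> \<le> C * (norm z)\<^sup>2"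
proof -
  have G: "\<And>y. y \<in> \<Omega> \<Longrightarrow> GDERIV u y :> gradient u y"
    using u by (auto simp: C11_loc_def)
  obtain r1 L where r1: "r1 > 0" and L: "L-lipschitz_on (ball x r1 \<inter> \<Omega>) (gradient u)"
    using u \<Omega> unfolding C11_loc_def by blast
  obtain r2 where r2: "r2 > 0" "ball x r2 \<subseteq> \<Omega>" using \<Omega> openE by blast
  define r where "r = min r1 r2"
  show ?thesis
  proof (rule that[of r "2 * L"])
    show "0 < r" using r1 r2 by (simp add: r_def)
    fix z :: 'a assume z: "norm z < r"
    \<comment> \<open>The second difference is \<open>h 1 - h 0\<close>, and the derivative of
      \<open>h\<close> is a difference of gradients at points \<open>2 * t * norm z\<close> apart.
      The mean value theorem and the Lipschitz bound therefore give two powers of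
      \<open>norm z\<close>.\<close>
    define h where "h t = u (x + t *\<^sub>R z) + u (x - t *\<^sub>R z)" for t
    have in_ball: "x + t *\<^sub>R z \<in> ball x r1 \<inter> \<Omega>" if "\<bar>t\<bar> \<le> 1" for t
    proof -
      have "norm (t *\<^sub>R z) \<le> 1 * norm z" unfolding norm_scaleR using that by (intro mult_right_mono) auto
      then have "dist x (x + t *\<^sub>R z) < r" using z by (simp add: dist_norm)
      then show ?thesis using r2 by (auto simp: r_def)
    qed
    have der: "(h has_real_derivative z \<bullet> (gradient u (x + t *\<^sub>R z) - gradient u (x - t *\<^sub>R z))) (at t)"
      if "0 \<le> t" "t \<le> 1" for t
    proof -
      have 1: "(u has_derivative (\<lambda>v. v \<bullet> gradient u (x + t *\<^sub>R z))) (at (x + t *\<^sub>R z))"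
        using G[of "x + t *\<^sub>R z"] in_ball[of t] that by (simp add: gderiv_def)
      have 2: "(u has_derivative (\<lambda>v. v \<bullet> gradient u (x - t *\<^sub>R z))) (at (x - t *\<^sub>R z))"
        using G[of "x - t *\<^sub>R z"] in_ball[of "- t"] that by (simp add: gderiv_def)
      have "((\<lambda>t. x + t *\<^sub>R z) has_derivative (\<lambda>h. h *\<^sub>R z)) (at t)"
        "((\<lambda>t. x - t *\<^sub>R z) has_derivative (\<lambda>h. - (h *\<^sub>R z))) (at t)"
        by (auto intro!: derivative_eq_intros)
      from has_derivative_add[OF has_derivative_compose[OF this(1) 1] has_derivative_compose[OF this(2) 2]]
      show ?thesis
        unfolding h_def has_field_derivative_def
        by (rule has_derivative_eq_rhs) (auto simp: fun_eq_iff inner_diff_right algebra_simps)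
    qed
    obtain \<xi> where \<xi>: "0 < \<xi>" "\<xi> < 1"
      "h 1 - h 0 = (1 - 0) * (z \<bullet> (gradient u (x + \<xi> *\<^sub>R z) - gradient u (x - \<xi> *\<^sub>R z)))"
      using MVT2[of 0 1 h "\<lambda>t. z \<bullet> (gradient u (x + t *\<^sub>R z) - gradient u (x - t *\<^sub>R z))"] der by auto
    have "dist (gradient u (x + \<xi> *\<^sub>R z)) (gradient u (x - \<xi> *\<^sub>R z)) \<le> L * dist (x + \<xi> *\<^sub>R z) (x - \<xi> *\<^sub>R z)"
      using lipschitz_onD[OF L in_ball[of \<xi>] in_ball[of "- \<xi>"]] \<xi> by simp
    also have "dist (x + \<xi> *\<^sub>R z) (x - \<xi> *\<^sub>R z) = 2 * \<xi> * norm z"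
      using \<xi> by (simp add: dist_norm scaleR_2[symmetric])
    also have "L * (2 * \<xi> * norm z) \<le> L * (2 * 1 * norm z)"
      using \<xi> lipschitz_on_nonneg[OF L] by (intro mult_left_mono mult_right_mono) auto
    finally have g: "norm (gradient u (x + \<xi> *\<^sub>R z) - gradient u (x - \<xi> *\<^sub>R z)) \<le> L * (2 * norm z)"
      by (simp add: dist_norm)
    have "\<bar>h 1 - h 0\<bar> \<le> norm z * norm (gradient u (x + \<xi> *\<^sub>R z) - gradient u (x - \<xi> *\<^sub>R z))"
      unfolding \<xi>(3) using Cauchy_Schwarz_ineq2 by simp
    also have "\<dots> \<le> norm z * (L * (2 * norm z))" using g by (intro mult_left_mono) auto
    finally show "\<bar>u (x + z) + u (x - z) - 2 * u x\<bar> \<le> 2 * L * (norm z)\<^sup>2"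
      by (simp add: h_def power2_eq_square algebra_simps)
  qed
qed

text \<open>The truncation limit is taken for each matrix separately, and the infimum only
  afterwards. The bound on the principal values uniform in \<open>A\<close> is essential: a
  real-valued \<open>INF\<close> lies below its members only if the set is bounded below.\<close>

lemma Fs_reflection_gap:
  fixes u :: "real ^ 'n \<Rightarrow> real" and x y0 :: "real ^ 'n" and k :: 'n and s \<mu> :: real
  defines "p \<equiv> real CARD('n) + 2 * s"
  defines "w \<equiv> \<lambda>y. u (hyper_refl k \<mu> y) - u y"
  defines "d \<equiv> \<mu> - x $ k"
  assumes \<theta>: "0 < \<theta>" "\<theta> \<le> \<Theta>" and u: "u \<in> L_space s" and s: "0 < s" "s < 1"
    and \<Omega>: "open \<Omega>" "u \<in> C11_loc \<Omega>" "x \<in> \<Omega>" "hyper_refl k \<mu> x \<in> \<Omega>"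
    and d: "0 < d" and m: "w x \<le> 0"
    and min: "\<And>y. y $ k < \<mu> \<Longrightarrow> w x \<le> w y"
    and cont: "isCont w x"
    and \<rho>: "0 < \<rho>" "\<rho> < dist x y0" and \<gamma>: "0 < \<gamma>" and c0: "0 < c0"
    and U: "\<And>y. y \<in> ball y0 \<rho> \<Longrightarrow> y $ k \<le> \<mu> - \<gamma> \<and> c0 \<le> w y - w x"
  shows "Fs \<theta> \<Theta> (axis k 1) s u x
      + (- w x) * (2 * unit_ball_vol (real CARD('n)) * (\<theta> / 3) powr p) * d powr (- 2 * s)
    < Fs \<theta> \<Theta> (axis k 1) s u (hyper_refl k \<mu> x)"
proof -
  define Rx where "Rx = hyper_refl k \<mu> x"
  define X where "X = (- w x) * (2 * unit_ball_vol (real CARD('n)) * (\<theta> / 3) powr p) * d powr (- 2 * s)"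
  define E where "E A z \<epsilon> = (LINT y:- ball z \<epsilon>|lebesgue. (u y - u z) / norm (matrix_inv A *v (y - z)) powr p)"
    for A :: "real ^ 'n ^ 'n" and z \<epsilon>
  define pv where "pv A z = pv_integral z (\<lambda>y. (u y - u z) / norm (matrix_inv A *v (y - z)) powr p)"
    for A :: "real ^ 'n ^ 'n" and z
  have \<Theta>: "0 < \<Theta>" using \<theta> by simp
  have pv: "\<exists>M. \<forall>A \<in> admissible \<theta> \<Theta> (axis k 1). \<bar>pv A z\<bar> \<le> M \<and> (E A z \<longlongrightarrow> pv A z) (at_right 0)"
    if z: "z \<in> \<Omega>" for z
  proof -
    obtain r C where "0 < r" "\<And>v. norm v < r \<Longrightarrow> \<bar>u (z + v) + u (z - v) - 2 * u z\<bar> \<le> C * (norm v)\<^sup>2"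
      using C11_loc_second_difference[OF \<Omega>(2,1) z] by metis
    from pv_truncation_converges[OF u s this(1) \<Theta> this(2)]
    obtain M where M: "\<And>B :: real ^ 'n ^ 'n. (\<And>z. norm z \<le> \<Theta> * norm (B *v z)) \<Longrightarrow>
      \<exists>l. \<bar>l\<bar> \<le> M \<and> ((\<lambda>\<epsilon>. LINT y:- ball z \<epsilon>|lebesgue.
        (u y - u z) / norm (B *v (y - z)) powr p) \<longlongrightarrow> l) (at_right 0)"
      unfolding p_def by blast
    show ?thesis
    proof (intro exI[of _ M] ballI)
      fix A :: "real ^ 'n ^ 'n" assume A: "A \<in> admissible \<theta> \<Theta> (axis k 1)"
      obtain l where l: "\<bar>l\<bar> \<le> M" "(E A z \<longlongrightarrow> l) (at_right 0)"
        using M[OF admissible_bounds(2)[OF A \<theta>(1)]] unfolding E_def by blast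
      have "pv A z = l"
        using tendsto_Lim[OF _ l(2)] unfolding pv_def pv_integral_def E_def by simp
      with l show "\<bar>pv A z\<bar> \<le> M \<and> (E A z \<longlongrightarrow> pv A z) (at_right 0)" by simp
    qed
  qed
  obtain \<delta> where \<delta>: "0 < \<delta>" and gap: "\<And>B :: real ^ 'n ^ 'n. \<lbrakk>\<And>z. norm z \<le> \<Theta> * norm (B *v z); \<And>z. \<theta> * norm (B *v z) \<le> norm z;
        \<exists>\<beta>\<ge>1 / \<Theta>. \<forall>z \<tau>. (norm (B *v (z + \<tau> *\<^sub>R axis k 1)))\<^sup>2
          = (norm (B *v z))\<^sup>2 + \<beta>\<^sup>2 * (2 * \<tau> * z $ k + \<tau>\<^sup>2)\<rbrakk> \<Longrightarrow>
      \<forall>\<^sub>F \<epsilon> in at_right 0. \<delta> + X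
        \<le> (LINT y:- ball Rx \<epsilon>|lebesgue. (u y - u Rx) / norm (B *v (y - Rx)) powr p)
          - (LINT y:- ball x \<epsilon>|lebesgue. (u y - u x) / norm (B *v (y - x)) powr p)"
    using truncated_reflection_gap[OF u s(1) \<theta>(1) \<Theta> d[unfolded d_def] m[unfolded w_def] min[unfolded w_def]
        cont[unfolded w_def] \<rho> \<gamma> c0 U[unfolded w_def]]
    unfolding X_def Rx_def w_def d_def p_def by blast
  obtain M where M: "\<And>A. A \<in> admissible \<theta> \<Theta> (axis k 1) \<Longrightarrow> \<bar>pv A x\<bar> \<le> M"
    and L1: "\<And>A. A \<in> admissible \<theta> \<Theta> (axis k 1) \<Longrightarrow> (E A x \<longlongrightarrow> pv A x) (at_right 0)"
    using pv[OF \<Omega>(3)] by blast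
  have L2: "\<And>A. A \<in> admissible \<theta> \<Theta> (axis k 1) \<Longrightarrow> (E A Rx \<longlongrightarrow> pv A Rx) (at_right 0)"
    using pv[OF \<Omega>(4)] unfolding Rx_def by blast
  have bdd: "bdd_below ((\<lambda>A. pv A x) ` admissible \<theta> \<Theta> (axis k 1))"
    by (rule bdd_belowI[of _ "- M"]) (use M in \<open>force simp: abs_le_iff\<close>)
  have Fs_eq: "Fs \<theta> \<Theta> (axis k 1) s u z = (INF A \<in> admissible \<theta> \<Theta> (axis k 1). pv A z)" for z
    by (simp add: Fs_def pv_def p_def)
  have "Fs \<theta> \<Theta> (axis k 1) s u x + (\<delta> + X) \<le> (INF A \<in> admissible \<theta> \<Theta> (axis k 1). pv A Rx)"
  proof (rule cINF_greatest)
    show "admissible \<theta> \<Theta> (axis k 1 :: real ^ 'n) \<noteq> {}"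
      using mat_admissible[OF \<theta>(2), of "axis k 1"] by (auto simp: axis_eq_0_iff)
    fix A :: "real ^ 'n ^ 'n" assume A: "A \<in> admissible \<theta> \<Theta> (axis k 1)"
    have "\<forall>\<^sub>F \<epsilon> in at_right 0. \<delta> + X \<le> E A Rx \<epsilon> - E A x \<epsilon>"
      unfolding E_def
    proof (rule gap)
      show "\<exists>\<beta>\<ge>1 / \<Theta>. \<forall>z \<tau>. (norm (matrix_inv A *v (z + \<tau> *\<^sub>R axis k 1)))\<^sup>2
          = (norm (matrix_inv A *v z))\<^sup>2 + \<beta>\<^sup>2 * (2 * \<tau> * z $ k + \<tau>\<^sup>2)"
        using admissible_shift[OF A \<theta>(1)] by metis
    qed (use admissible_bounds[OF A \<theta>(1)] in auto)
    then have "\<delta> + X \<le> pv A Rx - pv A x"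
      by (intro tendsto_lowerbound[OF tendsto_diff[OF L2[OF A] L1[OF A]]]) auto
    moreover have "Fs \<theta> \<Theta> (axis k 1) s u x \<le> pv A x"
      unfolding Fs_eq by (rule cINF_lower[OF bdd A])
    ultimately show "Fs \<theta> \<Theta> (axis k 1) s u x + (\<delta> + X) \<le> pv A Rx" by linarith
  qed
  then show ?thesis
    using \<delta> unfolding Fs_eq[symmetric] X_def Rx_def by simp
qed

section \<open>Minimal increments in an epigraph\<close>

lemma pt_nth [simp]: "pt x' t $ None = t" "pt x' t $ Some j = x' $ j"
  by (simp_all add: pt_def)

lemma pt_surj: "pt (\<chi> j. y $ Some j) (y $ None) = y"
  by (simp add: vec_eq_iff pt_def split: option.split)

lemma pt_linear: "pt (x' + h *\<^sub>R v) (t + h * a) = pt x' t + h *\<^sub>R pt v a"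
  by (simp add: vec_eq_iff pt_def split: option.split)

lemma pt_in_epigraph_set [simp]: "pt x' t \<in> epigraph_set \<phi> \<longleftrightarrow> \<phi> x' < t"
proof -
  have "x' = y' \<and> t = r" if "pt x' t = pt y' r" for y' r
    using that by (metis pt_nth vec_eq_iff)
  then show ?thesis by (fastforce simp: epigraph_set_def)
qed

lemma continuous_on_pt [continuous_intros]:
  "continuous_on S f \<Longrightarrow> continuous_on S g \<Longrightarrow> continuous_on S (\<lambda>z. pt (f z) (g z))"
  unfolding pt_def
proof (rule continuous_on_vec_lambda)
  fix i :: "'b option"
  assume "continuous_on S f" "continuous_on S g"
  then show "continuous_on S (\<lambda>z. case i of None \<Rightarrow> g z | Some j \<Rightarrow> f z $ j)"
    by (cases i) (auto intro: continuous_intros)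
qed

lemma hyper_refl_pt: "hyper_refl None \<mu> (pt x' t) = pt x' (2 * \<mu> - t)"
  by (simp add: hyper_refl_def vec_eq_iff pt_def axis_def split: option.split)

lemma eventually_nhds_less_0:
  fixes g :: "'a::topological_space \<Rightarrow> real"
  assumes "continuous_on UNIV g" "g c < 0"
  shows "\<forall>\<^sub>F y in nhds c. g y < 0"
  unfolding eventually_nhds
  by (rule exI[of _ "{y. g y < 0}"]) (use assms in \<open>auto intro: open_Collect_less continuous_on_const\<close>)

lemma isCont_hyper_refl: "isCont (hyper_refl k \<mu>) y"
  unfolding hyper_refl_def by (intro continuous_intros)

section \<open>Solutions on a coercive epigraph\<close>

locale epigraph_solution =
  fixes \<phi> :: "real ^ 'm \<Rightarrow> real"
    and \<Omega> :: "(real ^ ('m option)) set"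
    and u :: "real ^ ('m option) \<Rightarrow> real"
    and f :: "real ^ ('m option) \<Rightarrow> real \<Rightarrow> real ^ ('m option) \<Rightarrow> real"
    and \<theta> \<Theta> s :: real
  assumes \<theta>: "0 < \<theta>" "\<theta> \<le> \<Theta>" and s: "0 < s" "s < 1"
    and \<phi>_cont: "continuous_on UNIV \<phi>" and \<phi>_coercive: "coercive \<phi>" and \<Omega>: "\<Omega> = epigraph_set \<phi>"
    and u_L: "u \<in> L_space s" and u_C11: "u \<in> C11_loc \<Omega>" and u_cont: "continuous_on (closure \<Omega>) u"
    and pde: "\<And>x. x \<in> \<Omega> \<Longrightarrow> - Fs \<theta> \<Theta> e_last s u x = f x (u x) (gradient u x)"
    and u_pos: "\<And>x. x \<in> \<Omega> \<Longrightarrow> u x > 0" and u_zero: "\<And>x. x \<notin> \<Omega> \<Longrightarrow> u x = 0"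
    and f_F: "f \<in> F_class \<Omega>"
    and f_mono: "\<And>x' t t' v p' q. \<lbrakk>pt x' t \<in> \<Omega>; pt x' t' \<in> \<Omega>; (INF z. \<phi> z) \<le> t; 0 \<le> q; t \<le> t'\<rbrakk> \<Longrightarrow>
           f (pt x' t) v (pt p' q) \<le> f (pt x' t') v (pt p' (- q))"
begin

lemma pt_in_\<Omega>: "pt x' t \<in> \<Omega> \<longleftrightarrow> \<phi> x' < t"
  by (simp add: \<Omega>)

lemma in_\<Omega>_iff: "y \<in> \<Omega> \<longleftrightarrow> \<phi> (\<chi> j. y $ Some j) < y $ None"
  using pt_in_\<Omega>[of "\<chi> j. y $ Some j" "y $ None"] by (simp add: pt_surj)

lemma cont_\<phi>_proj: "continuous_on UNIV (\<lambda>y :: real ^ ('m option). \<phi> (\<chi> j. y $ Some j))"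
  by (intro continuous_on_compose2[OF \<phi>_cont] continuous_on_vec_lambda continuous_intros) auto

lemma open_\<Omega>: "open \<Omega>"
proof -
  have "\<Omega> = {y. \<phi> (\<chi> j. y $ Some j) < y $ None}" using in_\<Omega>_iff by auto
  then show ?thesis
    using cont_\<phi>_proj by (simp add: open_Collect_less continuous_intros)
qed

lemma u_nonneg: "0 \<le> u x"
  using u_pos[of x] u_zero[of x] by (cases "x \<in> \<Omega>") auto

lemma pt_in_closure: "\<phi> x' \<le> t \<Longrightarrow> pt x' t \<in> closure \<Omega>"
proof -
  assume t: "\<phi> x' \<le> t"
  have "((\<lambda>r. pt x' r) \<longlongrightarrow> pt x' t) (at_right t)"
  proof -
    have "continuous_on UNIV (\<lambda>r. pt x' r)" by (intro continuous_intros)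
    then have "isCont (\<lambda>r. pt x' r) t" by (simp add: continuous_on_eq_continuous_at)
    then show ?thesis unfolding isCont_def by (rule filterlim_at_split[THEN iffD1, THEN conjunct2])
  qed
  moreover have "\<forall>\<^sub>F r in at_right t. pt x' r \<in> \<Omega>"
    using t by (auto simp: pt_in_\<Omega> eventually_at_right_field intro!: exI[of _ "t + 1"])
  ultimately show ?thesis
    by (intro Lim_in_closed_set[OF closed_closure _ _ \<open>((\<lambda>r. pt x' r) \<longlongrightarrow> pt x' t) (at_right t)\<close>])
      (auto elim!: eventually_mono intro: subsetD[OF closure_subset])
qed

lemma isCont_u: "x \<in> \<Omega> \<Longrightarrow> isCont u x"
  using u_cont open_\<Omega> closure_subset continuous_on_subset continuous_on_eq_continuous_at by metis

lemma \<phi>_sublevel_bounded: obtains r where "\<And>x'. \<phi> x' \<le> c \<Longrightarrow> norm x' \<le> r"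
proof -
  have "\<forall>\<^sub>F x' in at_infinity. c < \<phi> x'"
    using \<phi>_coercive unfolding coercive_def filterlim_at_top_dense by blast
  then obtain r where "\<forall>x'. r \<le> norm x' \<longrightarrow> c < \<phi> x'"
    unfolding eventually_at_infinity by blast
  then show ?thesis using that[of r] by (metis linorder_not_le nle_le)
qed

lemma bdd_below_\<phi>: "bdd_below (range \<phi>)"
proof -
  obtain r where r: "\<And>x'. \<phi> x' \<le> 0 \<Longrightarrow> norm x' \<le> r" using \<phi>_sublevel_bounded by blast
  have "compact (\<phi> ` cball 0 r)"
    by (intro compact_continuous_image continuous_on_subset[OF \<phi>_cont]) auto
  then obtain c where c: "\<And>x'. norm x' \<le> r \<Longrightarrow> c \<le> \<phi> x'"
    using compact_imp_bounded bounded_imp_bdd_below unfolding bdd_below_def by (metis imageI mem_cball_0)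
  show ?thesis
    by (rule bdd_belowI[of _ "min c 0"]) (use c r in \<open>force simp: min_le_iff_disj\<close>)
qed

text \<open>As \<open>\<phi> x' < a < b\<close> are open conditions, any direction
  \<open>(v, \<alpha>, \<beta>)\<close> may be tested, subject only to the sum constraint
  \<open>h * (\<alpha> + \<beta>) \<le> 0\<close>. Directions with
  \<open>\<beta> = - \<alpha>\<close> are two-sided and give equations; \<open>(0, 0, - 1)\<close>
  is one-sided and gives the sign.\<close>

lemma gradients_at_joint_minimum:
  assumes a: "\<phi> x' < a" "a < b"
    and min: "\<And>y' t t'. \<lbrakk>\<phi> y' \<le> t; t \<le> t'; t + t' \<le> a + b\<rbrakk> \<Longrightarrow>
      u (pt x' b) - u (pt x' a) \<le> u (pt y' t') - u (pt y' t)"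
  obtains p' q where "0 \<le> q" "gradient u (pt x' a) = pt p' q" "gradient u (pt x' b) = pt p' (- q)"
proof -
  let ?P = "gradient u (pt x' a)" and ?Q = "gradient u (pt x' b)"
  have G: "(u has_derivative (\<lambda>v. v \<bullet> gradient u y)) (at y)" if "y \<in> \<Omega>" for y
    using u_C11 that unfolding C11_loc_def gderiv_def by auto
  define g where "g v \<alpha> \<beta> h = u (pt x' b + h *\<^sub>R pt v \<beta>) - u (pt x' a + h *\<^sub>R pt v \<alpha>)" for v \<alpha> \<beta> h
  have der: "(g v \<alpha> \<beta> has_real_derivative pt v \<beta> \<bullet> ?Q - pt v \<alpha> \<bullet> ?P) (at 0)" for v \<alpha> \<beta>
  proof -
    have c: "((\<lambda>h. u (y + h *\<^sub>R w)) has_real_derivative w \<bullet> gradient u y) (at 0)" if "y \<in> \<Omega>" for y w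
    proof -
      have 1: "((\<lambda>h. y + h *\<^sub>R w) has_derivative (\<lambda>h. h *\<^sub>R w)) (at 0)"
        by (auto intro!: derivative_eq_intros)
      have "(u has_derivative (\<lambda>v. v \<bullet> gradient u y)) (at (y + 0 *\<^sub>R w))"
        using G[OF that] by simp
      from has_derivative_compose[OF 1 this] show ?thesis
        unfolding has_field_derivative_def by (rule has_derivative_eq_rhs) (simp add: fun_eq_iff mult.commute)
    qed
    show ?thesis unfolding g_def
      by (intro DERIV_diff c) (use a in \<open>auto simp: pt_in_\<Omega>\<close>)
  qed
  have g_min: "\<forall>\<^sub>F h in nhds 0. h * (\<alpha> + \<beta>) \<le> 0 \<longrightarrow> g v \<alpha> \<beta> 0 \<le> g v \<alpha> \<beta> h" for v \<alpha> \<beta>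
  proof -
    have "\<forall>\<^sub>F h in nhds 0. \<phi> (x' + h *\<^sub>R v) - (a + h * \<alpha>) < 0"
      using a by (intro eventually_nhds_less_0 continuous_intros continuous_on_compose2[OF \<phi>_cont]) auto
    moreover have "\<forall>\<^sub>F h in nhds 0. (a + h * \<alpha>) - (b + h * \<beta>) < 0"
      using a by (intro eventually_nhds_less_0 continuous_intros) auto
    ultimately show ?thesis
    proof eventually_elim
      case (elim h)
      show ?case
      proof
        assume "h * (\<alpha> + \<beta>) \<le> 0"
        then show "g v \<alpha> \<beta> 0 \<le> g v \<alpha> \<beta> h"
          using min[of "x' + h *\<^sub>R v" "a + h * \<alpha>" "b + h * \<beta>"] elim
          by (simp add: g_def pt_linear[symmetric]) (simp add: algebra_simps)
      qed
    qed
  qed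
  have crit: "pt v (- \<alpha>) \<bullet> ?Q = pt v \<alpha> \<bullet> ?P" for v \<alpha>
  proof -
    obtain e where "e > 0" "\<And>h. \<bar>h\<bar> < e \<Longrightarrow> g v \<alpha> (- \<alpha>) 0 \<le> g v \<alpha> (- \<alpha>) h"
      using g_min[of \<alpha> "- \<alpha>" v] by (auto simp: eventually_nhds_metric dist_real_def)
    from DERIV_local_min[OF der this(1)] this(2) show ?thesis by simp
  qed
  have QS: "?Q $ Some j = ?P $ Some j" for j
  proof -
    have "pt (axis j 1) 0 = axis (Some j) 1"
      by (simp add: vec_eq_iff pt_def axis_def split: option.split)
    then show ?thesis using crit[of "axis j 1" 0] by (simp add: inner_axis')
  qed
  have e: "pt 0 r = r *\<^sub>R axis None 1" for r
    by (simp add: vec_eq_iff pt_def axis_def split: option.split)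
  have QN: "?Q $ None = - (?P $ None)"
    using crit[of 0 1] by (simp add: e inner_axis')
  have Q0: "?Q $ None \<le> 0"
  proof (rule ccontr)
    assume "\<not> ?Q $ None \<le> 0"
    then have "pt 0 (- 1) \<bullet> ?Q - pt 0 0 \<bullet> ?P < 0" by (simp add: e inner_axis')
    from DERIV_neg_dec_right[OF der this]
    obtain e1 where e1: "e1 > 0" "\<And>h. 0 < h \<Longrightarrow> h < e1 \<Longrightarrow> g 0 0 (- 1) h < g 0 0 (- 1) 0" by auto
    obtain e2 where e2: "e2 > 0" "\<And>h. \<bar>h\<bar> < e2 \<Longrightarrow> 0 \<le> h \<Longrightarrow> g 0 0 (- 1) 0 \<le> g 0 0 (- 1) h"
      using g_min[of 0 "- 1" 0] by (auto simp: eventually_nhds_metric dist_real_def)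
    define h where "h = min e1 e2 / 2"
    have "0 < h" "h < e1" "h < e2" using e1 e2 by (auto simp: h_def)
    then show False using e1(2)[of h] e2(2)[of h] by simp
  qed
  show ?thesis
  proof (rule that)
    show "0 \<le> ?P $ None" using QN Q0 by simp
    show "?P = pt (\<chi> j. ?P $ Some j) (?P $ None)" by (rule pt_surj[symmetric])
    have "?Q = pt (\<chi> j. ?Q $ Some j) (?Q $ None)" by (rule pt_surj[symmetric])
    then show "?Q = pt (\<chi> j. ?P $ Some j) (- (?P $ None))" by (simp only: QS QN)
  qed
qed

lemma joint_minimum_estimate:
  defines "c \<equiv> 2 * unit_ball_vol (real CARD('m option)) * (\<theta> / 3) powr (real CARD('m option) + 2 * s)"
  assumes a: "\<phi> x' \<le> a" "a < b" and m: "u (pt x' b) \<le> u (pt x' a)"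
    and min: "\<And>y' t t'. \<lbrakk>\<phi> y' \<le> t; t \<le> t'; t + t' \<le> a + b\<rbrakk> \<Longrightarrow>
      u (pt x' b) - u (pt x' a) \<le> u (pt y' t') - u (pt y' t)"
    and lip: "\<And>q. pt x' a \<in> \<Omega> \<Longrightarrow> \<bar>f (pt x' a) (u (pt x' a)) q - f (pt x' a) (u (pt x' b)) q\<bar>
      \<le> C * \<bar>u (pt x' a) - u (pt x' b)\<bar>"
  shows "u (pt x' b) < u (pt x' a) \<and> c * ((b - a) / 2) powr (- 2 * s) < C"
proof -
  define P where "P = pt x' a"
  define Q where "Q = pt x' b"
  define \<mu> where "\<mu> = (a + b) / 2"
  have \<mu>2: "2 * \<mu> = a + b" by (simp add: \<mu>_def)
  define w where "w y = u (hyper_refl None \<mu> y) - u y" for y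
  \<comment> \<open>A point outside the domain directly below \<open>P\<close>; its mirror image
    lies above \<open>Q\<close>, hence in the domain, so \<open>w\<close> is positive near
    \<open>y0\<close>.\<close>
  define y0 where "y0 = pt x' (\<phi> x' - 1)"
  have Q_in: "Q \<in> \<Omega>" using a by (simp add: Q_def pt_in_\<Omega>)
  have mPQ: "u Q \<le> u P" using m by (simp add: P_def Q_def)
  \<comment> \<open>Since \<open>u P \<ge> u Q > 0\<close>, the lower point cannot lie on the
    boundary, and the equation is available at both points.\<close>
  then have "u P \<noteq> 0" using u_pos[OF Q_in] by simp
  then have P_in: "P \<in> \<Omega>" using u_zero by blast
  then have a': "\<phi> x' < a" by (simp add: P_def pt_in_\<Omega>)
  have RP: "hyper_refl None \<mu> P = Q" by (simp add: P_def Q_def hyper_refl_pt \<mu>2)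
  have wP: "w P = u Q - u P" by (simp add: w_def RP)
  have d: "\<mu> - P $ None = (b - a) / 2" by (simp add: \<mu>_def P_def field_simps)
  \<comment> \<open>Minimality over pairs covers the points on or above the graph; below it
    \<open>u y = 0\<close>, so \<open>w y \<ge> 0 \<ge> w P\<close>.\<close>
  have wmin: "w P \<le> w y" if "y $ None < \<mu>" for y
  proof -
    define y' where "y' = (\<chi> j. y $ Some j)"
    define t where "t = y $ None"
    have y: "y = pt y' t" by (simp add: y'_def t_def pt_surj)
    show ?thesis
    proof (cases "\<phi> y' \<le> t")
      case True
      have "u Q - u P \<le> u (pt y' (2 * \<mu> - t)) - u (pt y' t)"
        unfolding P_def Q_def by (rule min[OF True]) (use that in \<open>simp_all add: \<mu>_def y\<close>)
      then show ?thesis unfolding wP by (simp add: w_def y hyper_refl_pt)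
    next
      case False
      then have "u y = 0" by (intro u_zero) (simp add: y pt_in_\<Omega>)
      then show ?thesis using u_nonneg[of "hyper_refl None \<mu> y"] mPQ unfolding wP by (simp add: w_def)
    qed
  qed
  have contR: "isCont (\<lambda>y. u (hyper_refl None \<mu> y)) y" if "hyper_refl None \<mu> y \<in> \<Omega>" for y
    by (rule isCont_o2[OF isCont_hyper_refl isCont_u[OF that]])
  have wcont: "isCont w P"
    unfolding w_def by (intro continuous_diff contR isCont_u P_in) (simp add: RP Q_in)
  define c0 where "c0 = u (hyper_refl None \<mu> y0) / 2"
  have Ry0: "hyper_refl None \<mu> y0 \<in> \<Omega>"
    using a' a(2) by (simp add: y0_def hyper_refl_pt pt_in_\<Omega> \<mu>2)
  then have c0: "c0 > 0" using u_pos by (simp add: c0_def)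
  have "\<forall>\<^sub>F y in nhds y0. y $ None - \<phi> (\<chi> j. y $ Some j) < 0"
    by (intro eventually_nhds_less_0 continuous_on_diff cont_\<phi>_proj continuous_intros)
      (simp add: y0_def)
  moreover have "\<forall>\<^sub>F y in nhds y0. c0 < u (hyper_refl None \<mu> y)"
    using contR[OF Ry0] c0 tendsto_at_iff_tendsto_nhds[of "\<lambda>y. u (hyper_refl None \<mu> y)" y0]
    by (intro order_tendstoD(1)[of _ "u (hyper_refl None \<mu> y0)"]) (auto simp: isCont_def c0_def)
  ultimately have "\<forall>\<^sub>F y in nhds y0. y $ None - \<phi> (\<chi> j. y $ Some j) < 0 \<and> c0 < u (hyper_refl None \<mu> y)"
    by (rule eventually_conj)
  then obtain r where r: "r > 0"
    "\<And>y. dist y y0 < r \<Longrightarrow> y $ None - \<phi> (\<chi> j. y $ Some j) < 0 \<and> c0 < u (hyper_refl None \<mu> y)"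
    unfolding eventually_nhds_metric by blast
  \<comment> \<open>A radius of at most \<open>1 / 2\<close> keeps the ball away from
    \<open>P\<close>, which is more than 1 above \<open>y0\<close>, and below the plane by at least
    \<open>1 / 2\<close>, the value used for \<open>\<gamma>\<close>.\<close>
  define \<rho> where "\<rho> = min r (1 / 2)"
  have "1 < \<bar>(P - y0) $ None\<bar>" using a' by (simp add: P_def y0_def)
  then have P_y0: "\<rho> < dist P y0"
    using component_le_norm_cart[of "P - y0" None] by (simp add: dist_norm \<rho>_def)
  have "Fs \<theta> \<Theta> e_last s u P + (- w P) * c * ((b - a) / 2) powr (- 2 * s)
    < Fs \<theta> \<Theta> e_last s u (hyper_refl None \<mu> P)"
    unfolding e_last_def c_def d[symmetric] w_def
  proof (rule Fs_reflection_gap[OF \<theta> u_L s open_\<Omega> u_C11 P_in, where ?y0.0 = y0 and \<rho> = \<rho> and \<gamma> = "1 / 2" and ?c0.0 = c0])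
    show "hyper_refl None \<mu> P \<in> \<Omega>" using Q_in by (simp add: RP)
    show "0 < \<mu> - P $ None" using a by (simp add: d)
    show "u (hyper_refl None \<mu> P) - u P \<le> 0" using mPQ by (simp add: RP)
    show "u (hyper_refl None \<mu> P) - u P \<le> u (hyper_refl None \<mu> y) - u y" if "y $ None < \<mu>" for y
      using wmin[OF that] by (simp add: w_def)
    show "isCont (\<lambda>y. u (hyper_refl None \<mu> y) - u y) P" using wcont by (simp add: w_def[abs_def])
    show "0 < \<rho>" using r by (simp add: \<rho>_def)
    show "y $ None \<le> \<mu> - 1 / 2 \<and> c0 \<le> u (hyper_refl None \<mu> y) - u y - (u (hyper_refl None \<mu> P) - u P)"
      if "y \<in> ball y0 \<rho>" for y
    proof
      have dy: "dist y y0 < r" "dist y y0 < 1 / 2" using that by (auto simp: \<rho>_def dist_commute)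
      then have "y \<notin> \<Omega>" using r(2)[of y] by (simp add: in_\<Omega>_iff)
      then show "c0 \<le> u (hyper_refl None \<mu> y) - u y - (u (hyper_refl None \<mu> P) - u P)"
        using r(2)[OF dy(1)] mPQ by (simp add: u_zero RP)
      have "\<bar>(y - y0) $ None\<bar> < 1 / 2"
        using component_le_norm_cart[of "y - y0" None] dy by (simp add: dist_norm)
      then have "\<bar>y $ None - (\<phi> x' - 1)\<bar> < 1 / 2" by (simp add: y0_def)
      then show "y $ None \<le> \<mu> - 1 / 2" using a' a(2) \<mu>2 by arith
    qed
  qed (use P_y0 c0 in auto)
  then have gap: "(u P - u Q) * c * ((b - a) / 2) powr (- 2 * s) < Fs \<theta> \<Theta> e_last s u Q - Fs \<theta> \<Theta> e_last s u P"
    by (simp add: RP wP)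
  obtain p' q where q: "0 \<le> q" "gradient u P = pt p' q" "gradient u Q = pt p' (- q)"
    using gradients_at_joint_minimum[OF a' a(2) min] unfolding P_def Q_def by blast
  have "(INF z. \<phi> z) \<le> a"
    using cINF_lower[OF bdd_below_\<phi>, of x'] a' by simp
  \<comment> \<open>The structure condition compares equal values of \<open>u\<close>, so it is
    applied with \<open>u Q\<close> at both points; the Lipschitz bound then replaces
    \<open>u Q\<close> by \<open>u P\<close> at \<open>P\<close>.\<close>
  then have "f P (u Q) (pt p' q) \<le> f Q (u Q) (pt p' (- q))"
    using f_mono[of x' a b q "u Q" p'] P_in Q_in q a(2) by (simp add: P_def Q_def)
  moreover have "\<bar>f P (u P) (pt p' q) - f P (u Q) (pt p' q)\<bar> \<le> C * (u P - u Q)"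
    using lip[of "pt p' q"] P_in mPQ by (simp add: P_def Q_def)
  moreover have "- Fs \<theta> \<Theta> e_last s u P = f P (u P) (pt p' q)" "- Fs \<theta> \<Theta> e_last s u Q = f Q (u Q) (pt p' (- q))"
    using pde[OF P_in] pde[OF Q_in] q by simp_all
  ultimately have "Fs \<theta> \<Theta> e_last s u Q - Fs \<theta> \<Theta> e_last s u P \<le> C * (u P - u Q)"
    by linarith
  \<comment> \<open>This strict inequality carries both conclusions: equality
    \<open>u P = u Q\<close> would read \<open>0 < 0\<close>, and otherwise the positive factor
    cancels.\<close>
  with gap have *: "(u P - u Q) * (c * ((b - a) / 2) powr (- 2 * s)) < (u P - u Q) * C"
    by (simp add: mult_ac)
  then have "u P - u Q \<noteq> 0" by auto
  moreover have "u P - u Q \<ge> 0" using mPQ by simp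
  ultimately have "u P - u Q > 0" by simp
  with * show ?thesis by (simp add: P_def Q_def)
qed

section \<open>The compact set of pairs and its minimisers\<close>

definition pairs :: "real \<Rightarrow> ((real ^ 'm) \<times> real \<times> real) set" where
  "pairs \<nu> = {(y, t, t'). \<phi> y \<le> t \<and> t \<le> t' \<and> t + t' \<le> 2 * \<nu>}"

definition increment :: "(real ^ 'm) \<times> real \<times> real \<Rightarrow> real" where
  "increment = (\<lambda>(y, t, t'). u (pt y t') - u (pt y t))"

lemma pairs_mono: "\<nu> \<le> \<nu>' \<Longrightarrow> pairs \<nu> \<subseteq> pairs \<nu>'"
  by (auto simp: pairs_def)

text \<open>Coercivity supplies compactness: \<open>\<phi> y \<le> t \<le> \<nu>\<close> confines
  \<open>y\<close> to a bounded sublevel set, and a lower bound of \<open>\<phi>\<close> bounds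
  \<open>t\<close> from below and thereby \<open>t'\<close> from above.\<close>

lemma compact_pairs: "compact (pairs \<nu>)"
proof -
  obtain r where r: "\<And>y. \<phi> y \<le> \<nu> \<Longrightarrow> norm y \<le> r" using \<phi>_sublevel_bounded by blast
  obtain l where l: "\<And>y. l \<le> \<phi> y" using bdd_below_\<phi> unfolding bdd_below_def by auto
  have "pairs \<nu> \<subseteq> cball 0 r \<times> {l..\<nu>} \<times> {l..2 * \<nu> - l}"
  proof
    fix z assume z: "z \<in> pairs \<nu>"
    obtain y t t' where yt: "z = (y, t, t')" by (cases z)
    with z have "\<phi> y \<le> t" "t \<le> t'" "t + t' \<le> 2 * \<nu>" by (auto simp: pairs_def)
    then show "z \<in> cball 0 r \<times> {l..\<nu>} \<times> {l..2 * \<nu> - l}"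
      using r[of y] l[of y] by (simp add: yt)
  qed
  then have "bounded (pairs \<nu>)"
    by (rule bounded_subset[rotated]) (intro bounded_Times bounded_cball bounded_closed_interval)
  moreover have "closed (pairs \<nu>)"
    unfolding pairs_def case_prod_unfold
    by (intro closed_Collect_conj closed_Collect_le continuous_intros continuous_on_compose2[OF \<phi>_cont]) auto
  ultimately show ?thesis by (simp add: compact_eq_bounded_closed)
qed

lemma continuous_on_increment: "continuous_on (pairs \<nu>) increment"
  unfolding increment_def case_prod_unfold
  by (intro continuous_on_diff continuous_on_compose2[OF u_cont] continuous_intros)
    (auto simp: pairs_def intro!: pt_in_closure)

lemma increment_minimum:
  assumes "(y, t, t') \<in> pairs \<nu>"
  obtains x' a b where "(x', a, b) \<in> pairs \<nu>"
    "\<And>z. z \<in> pairs \<nu> \<Longrightarrow> increment (x', a, b) \<le> increment z"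
  using continuous_attains_inf[OF compact_pairs _ continuous_on_increment, of \<nu>] assms by (metis empty_iff prod_cases3)

text \<open>One \<open>r\<close> serves all planes up to \<open>\<nu>\<close>, because the Lipschitz
  constant is taken on a single compact set. Minimality is asked only at the pair's own midpoint, so
  that the bound applies to a minimiser over any larger set of pairs.\<close>

lemma minimal_increment_gap:
  obtains r where "0 < r" "\<And>x' a b. \<lbrakk>(x', a, b) \<in> pairs \<nu>; a < b; increment (x', a, b) \<le> 0;
      \<And>z. z \<in> pairs ((a + b) / 2) \<Longrightarrow> increment (x', a, b) \<le> increment z\<rbrakk>
    \<Longrightarrow> increment (x', a, b) < 0 \<and> 2 * r < b - a"
proof -
  define c where "c = 2 * unit_ball_vol (real CARD('m option)) * (\<theta> / 3) powr (real CARD('m option) + 2 * s)"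
  have c: "c > 0" using \<theta> by (simp add: c_def)
  let ?K = "(\<lambda>(y, t, t'). pt y t) ` pairs \<nu>"
  have cont: "continuous_on (pairs \<nu>) (\<lambda>(y, t, t'). pt y t)"
    unfolding case_prod_unfold by (intro continuous_intros)
  have K: "compact ?K" by (rule compact_continuous_image[OF cont compact_pairs])
  have KC: "?K \<subseteq> closure \<Omega>" by (auto simp: pairs_def intro!: pt_in_closure)
  have "bounded (u ` ?K)"
    by (intro compact_imp_bounded compact_continuous_image K continuous_on_subset[OF u_cont KC])
  then obtain M where M: "M > 0" "\<And>y. y \<in> ?K \<Longrightarrow> \<bar>u y\<bar> \<le> M"
    unfolding bounded_pos by auto
  obtain C where C: "C > 0" "\<And>u1 u2 x p. \<lbrakk>u1 \<in> {-M..M}; u2 \<in> {-M..M}; x \<in> ?K \<inter> \<Omega>\<rbrakk> \<Longrightarrow>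
      \<bar>f x u1 p - f x u2 p\<bar> \<le> C * \<bar>u1 - u2\<bar>"
  proof -
    have "\<forall>M>0. \<forall>K. compact K \<and> K \<subseteq> closure \<Omega> \<longrightarrow>
      (\<exists>C>0. \<forall>u1\<in>{-M..M}. \<forall>u2\<in>{-M..M}. \<forall>x\<in>K \<inter> \<Omega>. \<forall>p. \<bar>f x u1 p - f x u2 p\<bar> \<le> C * \<bar>u1 - u2\<bar>)"
      using f_F unfolding F_class_def by (rule CollectD)
    from this[rule_format, OF M(1) conjI[OF K KC]] show ?thesis
      using that by metis
  qed
  \<comment> \<open>The solution of \<open>c * r powr (- 2 * s) = C\<close>.\<close>
  define r where "r = (c / C) powr (1 / (2 * s))"
  show ?thesis
  proof (rule that[of r])
    show "0 < r" using c C by (simp add: r_def)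
    fix x' a b
    assume ab: "(x', a, b) \<in> pairs \<nu>" "a < b" and inc: "increment (x', a, b) \<le> 0"
      and min: "\<And>z. z \<in> pairs ((a + b) / 2) \<Longrightarrow> increment (x', a, b) \<le> increment z"
    have P: "pt x' a \<in> ?K" using ab by force
    have le: "u (pt x' b) \<le> u (pt x' a)" using inc by (simp add: increment_def)
    have "u (pt x' b) < u (pt x' a) \<and> c * ((b - a) / 2) powr (- 2 * s) < C"
      unfolding c_def
    proof (rule joint_minimum_estimate)
      show "\<phi> x' \<le> a" using ab by (simp add: pairs_def)
      fix y' t t' assume "\<phi> y' \<le> t" "t \<le> t'" "t + t' \<le> a + b"
      then have "(y', t, t') \<in> pairs ((a + b) / 2)" by (simp add: pairs_def)
      from min[OF this] show "u (pt x' b) - u (pt x' a) \<le> u (pt y' t') - u (pt y' t)"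
        by (simp add: increment_def)
    next
      fix q assume "pt x' a \<in> \<Omega>"
      \<comment> \<open>The upper point need not belong to \<open>?K\<close>; its value is still in
        range, since \<open>0 \<le> u (pt x' b) \<le> u (pt x' a) \<le> M\<close>.\<close>
      then show "\<bar>f (pt x' a) (u (pt x' a)) q - f (pt x' a) (u (pt x' b)) q\<bar> \<le> C * \<bar>u (pt x' a) - u (pt x' b)\<bar>"
        using M(2)[OF P] u_nonneg[of "pt x' b"] u_nonneg[of "pt x' a"] le M(1) P by (intro C(2)) auto
    qed (use ab le in auto)
    moreover have "r < (b - a) / 2" if "c * ((b - a) / 2) powr (- 2 * s) < C"
    proof -
      define X where "X = ((b - a) / 2) powr (2 * s)"
      have "X > 0" using ab by (simp add: X_def)
      moreover have "((b - a) / 2) powr (- 2 * s) = 1 / X"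
        using powr_minus_divide[of "(b - a) / 2" "2 * s"] by (simp add: X_def)
      ultimately have "c / C < ((b - a) / 2) powr (2 * s)"
        using that C(1) unfolding X_def[symmetric] by (simp add: divide_less_eq mult.commute)
      then have "r < (((b - a) / 2) powr (2 * s)) powr (1 / (2 * s))"
        unfolding r_def using s c C by (intro powr_less_mono2) auto
      then show ?thesis using s ab by (simp add: powr_powr)
    qed
    ultimately show "increment (x', a, b) < 0 \<and> 2 * r < b - a"
      by (auto simp: increment_def)
  qed
qed

text \<open>Among the wide pairs with nonpositive increment, one with lowest midpoint \<open>\<mu>\<close> would have to
  minimise the increment over \<open>pairs \<mu>\<close>, since otherwise the minimiser could be lowered further.\<close>

lemma increment_nonneg:
  assumes "z \<in> pairs \<nu>"
  shows "0 \<le> increment z"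
proof (rule ccontr)
  obtain r where r: "0 < r" and gap: "\<And>x' a b. \<lbrakk>(x', a, b) \<in> pairs \<nu>; a < b; increment (x', a, b) \<le> 0;
      \<And>z. z \<in> pairs ((a + b) / 2) \<Longrightarrow> increment (x', a, b) \<le> increment z\<rbrakk>
    \<Longrightarrow> increment (x', a, b) < 0 \<and> 2 * r < b - a"
    using minimal_increment_gap[of \<nu>] by metis
  \<comment> \<open>The width bound removes the diagonal, where the increment is 0; both conditions
    are non-strict to make the set closed.\<close>
  define bad where "bad = {z \<in> pairs \<nu>. 2 * r \<le> snd (snd z) - fst (snd z) \<and> increment z \<le> 0}"
  \<comment> \<open>A negative minimum is attained off the diagonal and is also the minimum at its
    own, possibly lower, midpoint, so the gap applies and the width exceeds \<open>2 * r\<close>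
    strictly.\<close>
  have low: "\<exists>x' a b. (x', a, b) \<in> pairs \<mu> \<and> a < b \<and> 2 * r < b - a \<and> increment (x', a, b) < 0
      \<and> (\<forall>z\<in>pairs \<mu>. increment (x', a, b) \<le> increment z)"
    if "v \<in> pairs \<mu>" "increment v < 0" "\<mu> \<le> \<nu>" for v \<mu>
  proof -
    obtain y t t' where "v = (y, t, t')" by (cases v) auto
    with that(1) obtain x' a b where q: "(x', a, b) \<in> pairs \<mu>" "\<And>z. z \<in> pairs \<mu> \<Longrightarrow> increment (x', a, b) \<le> increment z"
      using increment_minimum by metis
    then have neg: "increment (x', a, b) < 0" using q(2)[OF that(1)] that(2) by simp
    then have "a \<noteq> b" by (auto simp: increment_def)
    then have ab: "a < b" using q(1) by (simp add: pairs_def)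
    have "pairs ((a + b) / 2) \<subseteq> pairs \<mu>" using q(1) by (intro pairs_mono) (simp add: pairs_def)
    then have "2 * r < b - a"
      using gap[of x' a b] q neg ab pairs_mono[OF that(3)] by (meson less_imp_le subsetD)
    then show ?thesis using q neg ab by blast
  qed
  assume "\<not> 0 \<le> increment z"
  then have "increment z < 0" by simp
  from low[OF assms this] obtain x0 a0 b0 where "(x0, a0, b0) \<in> bad"
    by (force simp: bad_def)
  then have ne: "bad \<noteq> {}" by blast
  have "bad = pairs \<nu> \<inter> {z. 2 * r \<le> snd (snd z) - fst (snd z)} \<inter> (pairs \<nu> \<inter> increment -` {..0})"
    by (auto simp: bad_def)
  moreover have "closed {z :: (real ^ 'm) \<times> real \<times> real. 2 * r \<le> snd (snd z) - fst (snd z)}"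
    by (intro closed_Collect_le continuous_intros)
  moreover have "closed (pairs \<nu> \<inter> increment -` {..0})"
    by (intro continuous_closed_preimage continuous_on_increment compact_imp_closed compact_pairs closed_atMost)
  ultimately have cb: "compact bad"
    using compact_pairs by (simp add: compact_Int_closed)
  have cc: "continuous_on bad (\<lambda>z. fst (snd z) + snd (snd z))"
    by (intro continuous_intros)
  obtain v where v: "v \<in> bad" "\<And>z. z \<in> bad \<Longrightarrow> fst (snd v) + snd (snd v) \<le> fst (snd z) + snd (snd z)"
    using continuous_attains_inf[OF cb ne cc] by blast
  obtain x' a b where vab: "v = (x', a, b)" by (cases v) auto
  define \<mu> where "\<mu> = (a + b) / 2"
  have vp: "(x', a, b) \<in> pairs \<mu>" "\<mu> \<le> \<nu>" "2 * r \<le> b - a" "increment (x', a, b) \<le> 0" "(x', a, b) \<in> pairs \<nu>"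
    using v(1) by (auto simp: vab bad_def pairs_def \<mu>_def)
  show False
  \<comment> \<open>If a negative increment occurs, the minimiser satisfies both defining conditions
    of \<open>bad\<close> strictly, so its upper end can be lowered slightly within
    \<open>bad\<close>, below the lowest midpoint. Otherwise \<open>v\<close> itself is a minimiser
    with increment 0, while the gap forces a negative one.\<close>
  proof (cases "\<exists>w\<in>pairs \<mu>. increment w < 0")
    case True
    then obtain x1 a1 b1 where q: "(x1, a1, b1) \<in> pairs \<mu>" "a1 < b1" "2 * r < b1 - a1" "increment (x1, a1, b1) < 0"
      using low vp(2) by metis
    have "pt x1 b1 \<in> \<Omega>" using q by (simp add: pt_in_\<Omega> pairs_def)
    have "isCont (\<lambda>h. pt x1 (b1 - h)) 0"
      using continuous_on_eq_continuous_at[of UNIV "\<lambda>h. pt x1 (b1 - h)"] by (auto intro!: continuous_intros)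
    then have "isCont (\<lambda>h. u (pt x1 (b1 - h))) 0"
      using isCont_u[OF \<open>pt x1 b1 \<in> \<Omega>\<close>] by (intro isCont_o2[of 0 _ u]) simp_all
    then have "\<forall>\<^sub>F h in at_right 0. u (pt x1 (b1 - h)) < u (pt x1 a1)"
      using q(4) unfolding isCont_def increment_def
      by (intro order_tendstoD(2)[of _ "u (pt x1 b1)"]) (auto simp: filterlim_at_split)
    moreover have "\<forall>\<^sub>F h in at_right 0. h < b1 - a1 - 2 * r"
      using q(3) by (intro order_tendstoD(2)[OF tendsto_ident_at]) auto
    moreover have "\<forall>\<^sub>F h in at_right (0::real). 0 < h"
      by (rule eventually_at_right_less)
    ultimately have "\<forall>\<^sub>F h in at_right 0. u (pt x1 (b1 - h)) < u (pt x1 a1) \<and> h < b1 - a1 - 2 * r \<and> 0 < h"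
      by (intro eventually_conj)
    then obtain h where h: "u (pt x1 (b1 - h)) < u (pt x1 a1)" "h < b1 - a1 - 2 * r" "0 < h"
      using eventually_happens'[OF trivial_limit_at_right_real] by blast
    then have "(x1, a1, b1 - h) \<in> bad"
      using q vp(2) r by (auto simp: bad_def pairs_def increment_def)
    from v(2)[OF this] show False
      using q(1) h by (simp add: vab pairs_def \<mu>_def)
  next
    case False
    then have "\<And>w. w \<in> pairs \<mu> \<Longrightarrow> increment (x', a, b) \<le> increment w"
      using vp(4) by force
    moreover have "a < b" using vp(3) r by simp
    ultimately show False
      using gap[OF vp(5)] vp False by (auto simp: \<mu>_def)
  qed
qed

text \<open>Once increments are nonnegative, a pair with increment 0 is a minimiser at its own
  midpoint, and the strict negativity in \<open>minimal_increment_gap\<close> rules it out.\<close>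

lemma u_strictly_increasing:
  assumes "\<phi> x' < a" "a < b"
  shows "u (pt x' a) < u (pt x' b)"
proof -
  define \<nu> where "\<nu> = (a + b) / 2"
  have p: "(x', a, b) \<in> pairs \<nu>" using assms by (simp add: pairs_def \<nu>_def)
  obtain r where gap: "\<And>x' a b. \<lbrakk>(x', a, b) \<in> pairs \<nu>; a < b; increment (x', a, b) \<le> 0;
      \<And>z. z \<in> pairs ((a + b) / 2) \<Longrightarrow> increment (x', a, b) \<le> increment z\<rbrakk>
    \<Longrightarrow> increment (x', a, b) < 0 \<and> 2 * r < b - a"
    using minimal_increment_gap[of \<nu>] by metis
  have "\<not> increment (x', a, b) \<le> 0"
  proof
    assume le: "increment (x', a, b) \<le> 0"
    have "increment (x', a, b) < 0"
      using gap[OF p assms(2) le] increment_nonneg le order_trans by blast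
    with increment_nonneg[OF p] show False by simp
  qed
  then show ?thesis by (simp add: increment_def)
qed

end

theorem theorem3p11:
  fixes \<phi> :: "real ^ 'm \<Rightarrow> real"
    and \<Omega> :: "(real ^ ('m option)) set"
    and u :: "real ^ ('m option) \<Rightarrow> real"
    and f :: "real ^ ('m option) \<Rightarrow> real \<Rightarrow> real ^ ('m option) \<Rightarrow> real"
    and \<theta> \<Theta> s :: real
  assumes "0 < \<theta>" and "\<theta> \<le> \<Theta>"
    and "0 < s" and "s < 1"
    and "continuous_on UNIV \<phi>" and "coercive \<phi>" and "\<Omega> = epigraph_set \<phi>"
    and "u \<in> L_space s" and "u \<in> C11_loc \<Omega>" and "continuous_on (closure \<Omega>) u"
    and "\<forall>x\<in>\<Omega>. - Fs \<theta> \<Theta> e_last s u x = f x (u x) (gradient u x)"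
    and "\<forall>x\<in>\<Omega>. u x > 0"
    and "\<forall>x. x \<notin> \<Omega> \<longrightarrow> u x = 0"
    and "f \<in> F_class \<Omega>"
    and "\<forall>x' t t' v p' q. pt x' t \<in> \<Omega> \<and> pt x' t' \<in> \<Omega> \<and>
           t \<ge> (INF z. \<phi> z) \<and> q \<ge> 0 \<and> t' \<ge> t \<longrightarrow>
           f (pt x' t) v (pt p' q) \<le> f (pt x' t') v (pt p' (- q))"
  shows "\<forall>x'. strict_mono_on {t. pt x' t \<in> \<Omega>} (\<lambda>t. u (pt x' t))"
proof -
  interpret epigraph_solution \<phi> \<Omega> u f \<theta> \<Theta> s
    using assms by unfold_locales blast+
  show ?thesis
    by (auto simp: strict_mono_on_def pt_in_\<Omega> intro: u_strictly_increasing)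
qed

end
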